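(* Let $0' = \{f\in\omega^\omega \mid f \text{ is not computable}\}$ and let $\mathcal{B} \subseteq \omega^\omega$ be a mass problem with $\mathcal{B} >_{\mathcal{M}} 0'$. Then $\mathrm{Th}(\mathcal{M}/\mathcal{B}) \subseteq \mathrm{Jan}$.
   Context: Medvedev lattice: mass problems are subsets of $\omega^\omega$. $\mathcal{X} \leq_{\mathcal{M}} \mathcal{Y}$ iff there is a Turing functional $\Phi$ with $\Phi(\mathcal{Y}) \subseteq \mathcal{X}$ (i.e. for every $f\in\mathcal{Y}$, $\Phi(f)$ is total and belongs to $\mathcal{X}$); $\mathcal{B} >_{\mathcal{M}} 0'$ means $0'\leq_{\mathcal{M}}\mathcal{B}$ and $\mathcal{B}\not\leq_{\mathcal{M}}0'$. $\equiv_{\mathcal{M}}$ is the induced equivalence, its classes are the Medvedev degrees, and $\mathcal{M}$ is the ordered set of Medvedev degrees; a mass problem is also used to denote its degree. $\mathcal{M}$ is a bounded distributive lattice with join $\mathcal{X}\oplus\mathcal{Y} = \{f\oplus g \mid f\in\mathcal{X}, g\in\mathcal{Y}\}$, meet $\mathcal{X}\otimes\mathcal{Y} = \{0^\frown f\mid f\in\mathcal{X}\}\cup\{1^\frown g\mid g\in\mathcal{Y}\}$ (where $i^\frown f$ is the function with first value $i$ followed by the values of $f$), bottom $0$ = degree of $\omega^\omega$, top $1$ = degree of $\emptyset$. Brouwer algebras: a Brouwer algebra is a bounded distributive lattice (join $\oplus$, meet $\otimes$) with a binary operation $\to$ such that $a\oplus c\geq b$ iff $c\geq a\to b$. $\mathcal{M}$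 is a Brouwer algebra with $\mathcal{X}\to\mathcal{Y} = \{n^\frown f \mid \forall g\in\mathcal{X}\,(\Phi_n(f\oplus g)\in\mathcal{Y})\}$, where $\Phi_n$ is the $n$-th Turing functional. For a Brouwer algebra $\mathscr{B}$ and $x\in\mathscr{B}$, $\mathscr{B}/x$ denotes the quotient of $\mathscr{B}$ by the principal filter $\{z\mid z\geq x\}$; it is isomorphic to the interval $[0,x]_{\mathscr{B}}$ (with the operations $\oplus,\otimes,\to$ of $\mathscr{B}$, bottom $0$ and top $x$) and is a Brouwer algebra. Theories: a propositional formula $\varphi(x_1,\dots,x_n)$ is evaluated at $b_1,\dots,b_n$ in a Brouwer algebra $\mathscr{B}$ by interpreting $\vee$ as $\otimes$, $\wedge$ as $\oplus$, implication as $\to$, and $\bot$ as $1$ (with $\neg\alpha$ being $\alpha\to\bot$). $\mathrm{Th}(\mathscr{B})$ is the set of formulas evaluating to $0$ under all valuations. $\mathrm{Jan}$ (Jankov's logic) is the deductive closure (under modus ponens and substitution) of intuitionistic propositional logic $\mathrm{IPC}$ together with the weak law of the excluded middle $\neg p\vee\neg\neg p$. *)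

theory Defs
  imports Main "HOL-Library.Nat_Bijection"
begin

section \<open>Turing functionals\<close>

text \<open>
  Programs for the partial functions that are recursive in an oracle (Kleene's schemata). All
  functions are unary; several arguments are passed through the pairing function
  \<^const>\<open>prod_encode\<close>.
\<close>

datatype prog =
    PZero | PSucc | PFst | PSnd | PQuery
  | PPair prog prog | PComp prog prog | PPrec prog prog | PMu prog

primrec run :: "(nat \<Rightarrow> nat) \<Rightarrow> prog \<Rightarrow> nat \<Rightarrow> nat option" where
  "run f PZero = (\<lambda>x. Some 0)"
| "run f PSucc = (\<lambda>x. Some (Suc x))"
| "run f PFst = (\<lambda>x. Some (fst (prod_decode x)))"
| "run f PSnd = (\<lambda>x. Some (snd (prod_decode x)))"
| "run f PQuery = (\<lambda>x. Some (f x))"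
| "run f (PPair c d) =
     (\<lambda>x. Option.bind (run f c x) (\<lambda>y. Option.bind (run f d x) (\<lambda>z. Some (prod_encode (y, z)))))"
| "run f (PComp c d) = (\<lambda>x. Option.bind (run f d x) (run f c))"
| "run f (PPrec c d) =
     (\<lambda>x. rec_nat (run f c (fst (prod_decode x)))
        (\<lambda>m r. Option.bind r (\<lambda>y. run f d (prod_encode (fst (prod_decode x), prod_encode (m, y)))))
        (snd (prod_decode x)))"
| "run f (PMu c) =
     (\<lambda>x. let P = (\<lambda>n. run f c (prod_encode (x, n)) = Some 0 \<and>
                       (\<forall>m<n. run f c (prod_encode (x, m)) \<noteq> None))
          in if \<exists>n. P n then Some (LEAST n. P n) else None)"

text \<open>The program with number \<open>n\<close>; \<open>prog_encode\<close> below is the inverse bijection.\<close>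

function prog_decode :: "nat \<Rightarrow> prog" where
  "prog_decode n =
    (if n = 0 then PZero
     else if n = 1 then PSucc
     else if n = 2 then PFst
     else if n = 3 then PSnd
     else if n = 4 then PQuery
     else
       let k = (n - 5) div 4; t = (n - 5) mod 4 in
       if t = 3 then PMu (prog_decode k)
       else
         let c = prog_decode (fst (prod_decode k)); d = prog_decode (snd (prod_decode k)) in
         if t = 0 then PPair c d
         else if t = 1 then PComp c d
         else PPrec c d)"
  by auto
termination
proof (relation "measure (\<lambda>n. n)", goal_cases)
  case 1
  then show ?case by simp
next
  case 2
  then show ?case by auto
next
  case (3 n k t)
  have "fst (prod_decode k) \<le> k"
    by (metis le_prod_encode_1 prod.collapse prod_decode_inverse)
  also have "k < n" using 3 by auto
  finally show ?case by simp
next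
  case (4 n k t c)
  have "snd (prod_decode k) \<le> k"
    by (metis le_prod_encode_2 prod.collapse prod_decode_inverse)
  also have "k < n" using 4 by auto
  finally show ?case by simp
qed

declare prog_decode.simps [simp del]

primrec prog_encode :: "prog \<Rightarrow> nat" where
  "prog_encode PZero = 0"
| "prog_encode PSucc = 1"
| "prog_encode PFst = 2"
| "prog_encode PSnd = 3"
| "prog_encode PQuery = 4"
| "prog_encode (PPair c d) = 4 * prod_encode (prog_encode c, prog_encode d) + 5"
| "prog_encode (PComp c d) = 4 * prod_encode (prog_encode c, prog_encode d) + 6"
| "prog_encode (PPrec c d) = 4 * prod_encode (prog_encode c, prog_encode d) + 7"
| "prog_encode (PMu c) = 4 * prog_encode c + 8"

lemma prog_decode_step:
  assumes "t < 4"
  shows "prog_decode (4 * k + 5 + t) =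
    (if t = 3 then PMu (prog_decode k)
     else
       let c = prog_decode (fst (prod_decode k)); d = prog_decode (snd (prod_decode k)) in
       if t = 0 then PPair c d
       else if t = 1 then PComp c d
       else PPrec c d)"
proof -
  have "(4 * k + 5 + t - 5) div 4 = k" "(4 * k + 5 + t - 5) mod 4 = t"
    using assms by auto
  moreover have "4 * k + 5 + t \<noteq> 0" "4 * k + 5 + t \<noteq> 1" "4 * k + 5 + t \<noteq> 2"
    "4 * k + 5 + t \<noteq> 3" "4 * k + 5 + t \<noteq> 4"
    by auto
  ultimately show ?thesis
    by (subst prog_decode.simps) (simp only: Let_def if_False)
qed

lemma prog_decode_encode [simp]: "prog_decode (prog_encode c) = c"
proof (induction c)
  case (PPair c d)
  then show ?case
    using prog_decode_step[of 0 "prod_encode (prog_encode c, prog_encode d)"]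
    by (simp add: Let_def ac_simps)
next
  case (PComp c d)
  then show ?case
    using prog_decode_step[of 1 "prod_encode (prog_encode c, prog_encode d)"]
    by (simp add: Let_def ac_simps)
next
  case (PPrec c d)
  then show ?case
    using prog_decode_step[of 2 "prod_encode (prog_encode c, prog_encode d)"]
    by (simp add: Let_def ac_simps)
next
  case (PMu c)
  then show ?case
    using prog_decode_step[of 3 "prog_encode c"]
    by (simp add: Let_def ac_simps)
qed (subst prog_decode.simps, simp)+

definition Phi :: "nat \<Rightarrow> (nat \<Rightarrow> nat) \<Rightarrow> nat \<Rightarrow> nat option" where
  "Phi n f = run f (prog_decode n)"

text \<open>The partial function \<open>p\<close> is total and, as a total function, belongs to \<open>X\<close>.\<close>

definition total_in :: "(nat \<Rightarrow> nat option) \<Rightarrow> (nat \<Rightarrow> nat) set \<Rightarrow> bool" where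
  "total_in p X \<longleftrightarrow> (\<exists>g\<in>X. p = Some \<circ> g)"

primrec oracle_free :: "prog \<Rightarrow> bool" where
  "oracle_free PZero = True"
| "oracle_free PSucc = True"
| "oracle_free PFst = True"
| "oracle_free PSnd = True"
| "oracle_free PQuery = False"
| "oracle_free (PPair c d) = (oracle_free c \<and> oracle_free d)"
| "oracle_free (PComp c d) = (oracle_free c \<and> oracle_free d)"
| "oracle_free (PPrec c d) = (oracle_free c \<and> oracle_free d)"
| "oracle_free (PMu c) = oracle_free c"

text \<open>The oracle of an oracle-free program is never consulted; the zero function is a dummy.\<close>

definition computable :: "(nat \<Rightarrow> nat) \<Rightarrow> bool" where
  "computable f \<longleftrightarrow> (\<exists>c. oracle_free c \<and> run (\<lambda>_. 0) c = Some \<circ> f)"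


section \<open>Mass problems\<close>

type_synonym mass = "(nat \<Rightarrow> nat) set"

definition medv_le :: "mass \<Rightarrow> mass \<Rightarrow> bool" where
  "medv_le X Y \<longleftrightarrow> (\<exists>n. \<forall>f\<in>Y. total_in (Phi n f) X)"

definition medv_less :: "mass \<Rightarrow> mass \<Rightarrow> bool" where
  "medv_less X Y \<longleftrightarrow> medv_le X Y \<and> \<not> medv_le Y X"

definition medv_eq :: "(mass \<times> mass) set" where
  "medv_eq = {(X, Y). medv_le X Y \<and> medv_le Y X}"

definition fun_join :: "(nat \<Rightarrow> nat) \<Rightarrow> (nat \<Rightarrow> nat) \<Rightarrow> nat \<Rightarrow> nat" where
  "fun_join f g n = (if even n then f (n div 2) else g (n div 2))"

definition fun_cons :: "nat \<Rightarrow> (nat \<Rightarrow> nat) \<Rightarrow> nat \<Rightarrow> nat" where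
  "fun_cons i f n = (case n of 0 \<Rightarrow> i | Suc k \<Rightarrow> f k)"

definition mass_join :: "mass \<Rightarrow> mass \<Rightarrow> mass" where
  "mass_join X Y = {fun_join f g | f g. f \<in> X \<and> g \<in> Y}"

definition mass_meet :: "mass \<Rightarrow> mass \<Rightarrow> mass" where
  "mass_meet X Y = fun_cons 0 ` X \<union> fun_cons 1 ` Y"

definition mass_imp :: "mass \<Rightarrow> mass \<Rightarrow> mass" where
  "mass_imp X Y = {fun_cons n f | n f. \<forall>g\<in>X. total_in (Phi n (fun_join f g)) Y}"

definition zero_prime :: mass where
  "zero_prime = {f. \<not> computable f}"

primrec oracle_subst :: "prog \<Rightarrow> prog \<Rightarrow> prog" where
  "oracle_subst e PZero = PZero"
| "oracle_subst e PSucc = PSucc"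
| "oracle_subst e PFst = PFst"
| "oracle_subst e PSnd = PSnd"
| "oracle_subst e PQuery = e"
| "oracle_subst e (PPair c d) = PPair (oracle_subst e c) (oracle_subst e d)"
| "oracle_subst e (PComp c d) = PComp (oracle_subst e c) (oracle_subst e d)"
| "oracle_subst e (PPrec c d) = PPrec (oracle_subst e c) (oracle_subst e d)"
| "oracle_subst e (PMu c) = PMu (oracle_subst e c)"

lemma run_oracle_subst: "run f e = Some \<circ> g \<Longrightarrow> run f (oracle_subst e c) = run g c"
  by (induction c) auto

lemma medv_le_refl: "medv_le X X"
proof -
  have "total_in (Phi (prog_encode PQuery) f) X" if "f \<in> X" for f
    using that by (auto simp: total_in_def Phi_def fun_eq_iff simp del: prog_encode.simps)
  then show ?thesis by (auto simp: medv_le_def)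
qed

lemma medv_le_trans:
  assumes "medv_le X Y" "medv_le Y Z"
  shows "medv_le X Z"
proof -
  obtain m where m: "\<And>f. f \<in> Y \<Longrightarrow> total_in (Phi m f) X"
    using assms(1) unfolding medv_le_def by blast
  obtain n where n: "\<And>f. f \<in> Z \<Longrightarrow> total_in (Phi n f) Y"
    using assms(2) unfolding medv_le_def by blast
  have "total_in (Phi (prog_encode (oracle_subst (prog_decode n) (prog_decode m))) f) X"
    if f: "f \<in> Z" for f
  proof -
    obtain g where g: "g \<in> Y" and "run f (prog_decode n) = Some \<circ> g"
      using n[OF f] unfolding total_in_def Phi_def by blast
    then have "run f (oracle_subst (prog_decode n) (prog_decode m)) = run g (prog_decode m)"
      by (intro run_oracle_subst)
    with m[OF g] show ?thesis by (simp add: Phi_def)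
  qed
  then show ?thesis unfolding medv_le_def by blast
qed

lemma equiv_medv_eq: "equiv UNIV medv_eq"
proof (rule equivI)
  show "refl medv_eq" by (simp add: refl_on_def medv_eq_def medv_le_refl)
  show "sym medv_eq" by (auto simp: sym_def medv_eq_def)
  show "trans medv_eq" unfolding trans_def medv_eq_def by (blast intro: medv_le_trans)
qed simp


section \<open>Brouwer algebras\<close>

text \<open>
  The order is dual to that of Heyting algebras: \<open>imp L a b\<close> is the least \<open>c\<close> with
  \<open>b \<le> join L a c\<close>.
\<close>

record 'a brouwer =
  carrier :: "'a set"
  join :: "'a \<Rightarrow> 'a \<Rightarrow> 'a"
  meet :: "'a \<Rightarrow> 'a \<Rightarrow> 'a"
  imp :: "'a \<Rightarrow> 'a \<Rightarrow> 'a"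
  least :: 'a
  greatest :: 'a

text \<open>
  The operation induced by \<open>h\<close> on the classes of \<open>R\<close>; this is a single class when \<open>R\<close> is a
  congruence for \<open>h\<close>.
\<close>

definition lift2 :: "('a \<times> 'a) set \<Rightarrow> ('a \<Rightarrow> 'a \<Rightarrow> 'a) \<Rightarrow> 'a set \<Rightarrow> 'a set \<Rightarrow> 'a set" where
  "lift2 R h p q = (\<Union>a\<in>p. \<Union>b\<in>q. R `` {h a b})"

definition degree :: "mass \<Rightarrow> mass set" where
  "degree X = medv_eq `` {X}"

definition medvedev :: "mass set brouwer" where
  "medvedev =
    \<lparr>carrier = UNIV // medv_eq,
     join = lift2 medv_eq mass_join,
     meet = lift2 medv_eq mass_meet,
     imp = lift2 medv_eq mass_imp,
     least = degree UNIV,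
     greatest = degree {}\<rparr>"

definition le :: "'a brouwer \<Rightarrow> 'a \<Rightarrow> 'a \<Rightarrow> bool" where
  "le L a b \<longleftrightarrow> meet L a b = a"

text \<open>The lattice congruence induced by a filter \<open>F\<close>, collapsing \<open>F\<close> to the top element.\<close>

definition filter_cong :: "'a brouwer \<Rightarrow> 'a set \<Rightarrow> ('a \<times> 'a) set" where
  "filter_cong L F =
    {(a, b). a \<in> carrier L \<and> b \<in> carrier L \<and> (\<exists>z\<in>F. meet L a z = meet L b z)}"

text \<open>
  The quotient is formed as a lattice: \<^const>\<open>filter_cong\<close> need not respect the implication of \<open>L\<close>,
  so the implication of the quotient is the one determined by the order \<open>x \<le> y \<longleftrightarrow> m x y = x\<close> of the
  quotient lattice: \<open>q \<le> j p s \<longleftrightarrow> imp p q \<le> s\<close>.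
\<close>

definition filter_quotient :: "'a brouwer \<Rightarrow> 'a set \<Rightarrow> 'a set brouwer" where
  "filter_quotient L F =
    (let R = filter_cong L F;
         C = carrier L // R;
         j = lift2 R (join L);
         m = lift2 R (meet L)
     in \<lparr>carrier = C,
         join = j,
         meet = m,
         imp = (\<lambda>p q. THE r. r \<in> C \<and> (\<forall>s\<in>C. m q (j p s) = q \<longleftrightarrow> m r s = r)),
         least = R `` {least L},
         greatest = R `` {greatest L}\<rparr>)"

definition factor :: "'a brouwer \<Rightarrow> 'a \<Rightarrow> 'a set brouwer" where
  "factor L x = filter_quotient L {z \<in> carrier L. le L x z}"


section \<open>Propositional formulas, theories and Jankov's logic\<close>

datatype form =
    Var nat | Falsum | And form form | Or form form | Imp form form

abbreviation Neg :: "form \<Rightarrow> form" where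
  "Neg A \<equiv> Imp A Falsum"

primrec val :: "'a brouwer \<Rightarrow> (nat \<Rightarrow> 'a) \<Rightarrow> form \<Rightarrow> 'a" where
  "val L v (Var i) = v i"
| "val L v Falsum = greatest L"
| "val L v (And A B) = join L (val L v A) (val L v B)"
| "val L v (Or A B) = meet L (val L v A) (val L v B)"
| "val L v (Imp A B) = imp L (val L v A) (val L v B)"

definition Th :: "'a brouwer \<Rightarrow> form set" where
  "Th L = {A. \<forall>v. (\<forall>i. v i \<in> carrier L) \<longrightarrow> val L v A = least L}"

primrec subst :: "(nat \<Rightarrow> form) \<Rightarrow> form \<Rightarrow> form" where
  "subst s (Var i) = s i"
| "subst s Falsum = Falsum"
| "subst s (And A B) = And (subst s A) (subst s B)"
| "subst s (Or A B) = Or (subst s A) (subst s B)"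
| "subst s (Imp A B) = Imp (subst s A) (subst s B)"

inductive_set IPC :: "form set" where
  K: "Imp A (Imp B A) \<in> IPC"
| S: "Imp (Imp A (Imp B C)) (Imp (Imp A B) (Imp A C)) \<in> IPC"
| AndE1: "Imp (And A B) A \<in> IPC"
| AndE2: "Imp (And A B) B \<in> IPC"
| AndI: "Imp A (Imp B (And A B)) \<in> IPC"
| OrI1: "Imp A (Or A B) \<in> IPC"
| OrI2: "Imp B (Or A B) \<in> IPC"
| OrE: "Imp (Imp A C) (Imp (Imp B C) (Imp (Or A B) C)) \<in> IPC"
| FalsumE: "Imp Falsum A \<in> IPC"
| MP: "A \<in> IPC \<Longrightarrow> Imp A B \<in> IPC \<Longrightarrow> B \<in> IPC"

inductive_set Jan :: "form set" where
  IPC: "A \<in> IPC \<Longrightarrow> A \<in> Jan"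
| WLEM: "Or (Neg (Var 0)) (Neg (Neg (Var 0))) \<in> Jan"
| MP: "A \<in> Jan \<Longrightarrow> Imp A B \<in> Jan \<Longrightarrow> B \<in> Jan"
| Subst: "A \<in> Jan \<Longrightarrow> subst s A \<in> Jan"

end

theory Submission
  imports Defs Complex_Main "HOL-Library.Countable_Set"
begin

text \<open>
  Since \<open>B\<close> is not reducible to \<open>0'\<close>, there are noncomputable functions \<open>g\<^sub>p\<close>, one for each program
  \<open>p\<close>, such that \<open>p\<close> does not map \<open>g\<^sub>p\<close> into \<open>B\<close>. By cone avoidance every finite set \<open>T\<close> carries an
  antichain \<open>F\<close> of Turing degrees such that no \<open>g\<^sub>p\<close> is computable from any \<open>F s\<close>. For \<open>S \<subseteq> T\<close> let
  \<open>C\<^sub>S\<close> be the set of functions that are computable from no \<open>F s\<close> with \<open>s \<in> S\<close>. Then \<open>B\<close> is not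
  reducible to \<open>C\<^sub>T\<close>, as \<open>C\<^sub>T\<close> contains all \<open>g\<^sub>p\<close>. Moreover \<open>C\<^sub>S \<rightarrow> C\<^sub>R\<close> is \<open>C\<^bsub>R - S\<^esub>\<close>, and
  \<open>C\<^sub>S \<rightarrow> -\<close> commutes with meets because \<open>C\<^sub>S\<close> is closed under finite modifications. Put
  \<open>E = C\<^sub>T \<rightarrow> B\<close>. Sending an upset \<open>\<V>\<close> of \<open>(Pow T, \<subseteq>)\<close> to the meet of \<open>E\<close> and all \<open>C\<^sub>S\<close> with
  \<open>S \<in> \<V>\<close>, and the empty upset to \<open>B\<close>, then embeds the Brouwer algebra of upsets into the interval
  below \<open>B\<close>, without mapping an upset that omits \<open>{}\<close> to \<open>0\<close>. Finally, Jankov's logic is complete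
  for the Kripke frames \<open>(Pow T, \<subseteq>)\<close>.
\<close>

section \<open>Functions computable relative to an oracle\<close>

abbreviation pfst :: "nat \<Rightarrow> nat" where "pfst x \<equiv> fst (prod_decode x)"
abbreviation psnd :: "nat \<Rightarrow> nat" where "psnd x \<equiv> snd (prod_decode x)"

text \<open>The program is chosen before the oracle, so such an \<open>F\<close> can serve directly
  as a Medvedev reduction (\<open>medv_leI\<close>).\<close>

definition total_rec :: "((nat \<Rightarrow> nat) \<Rightarrow> nat \<Rightarrow> nat) \<Rightarrow> bool" where
  "total_rec F \<longleftrightarrow> (\<exists>p. \<forall>f. run f p = Some \<circ> F f)"

definition partial_rec :: "((nat \<Rightarrow> nat) \<Rightarrow> nat \<Rightarrow> nat option) \<Rightarrow> bool" where
  "partial_rec G \<longleftrightarrow> (\<exists>p. \<forall>f. run f p = G f)"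

definition decidable :: "((nat \<Rightarrow> nat) \<Rightarrow> nat \<Rightarrow> bool) \<Rightarrow> bool" where
  "decidable P \<longleftrightarrow> total_rec (\<lambda>f x. if P f x then 1 else 0)"

named_theorems rec_intros

lemma total_recI: "(\<And>f x. run f p x = Some (F f x)) \<Longrightarrow> total_rec F"
  unfolding total_rec_def by (rule exI[of _ p]) auto

lemma total_recE:
  assumes "total_rec F"
  obtains p where "\<forall>f x. run f p x = Some (F f x)"
  using assms unfolding total_rec_def by (metis comp_apply)

lemma partial_recE:
  assumes "partial_rec G"
  obtains p where "\<forall>f x. run f p x = G f x"
  using assms unfolding partial_rec_def by metis

lemma total_rec_id [rec_intros]: "total_rec (\<lambda>f x. x)"
  \<comment> \<open>The identity is not a primitive; pairing the two projections rebuilds the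
    input.\<close>
  by (rule total_recI[of "PPair PFst PSnd"]) simp

lemma total_rec_const [rec_intros]: "total_rec (\<lambda>f x. n)"
proof (induction n)
  case 0
  show ?case by (rule total_recI[of PZero]) simp
next
  case (Suc n)
  then obtain p where "\<forall>f x. run f p x = Some n" by (rule total_recE)
  then show ?case by (intro total_recI[of "PComp PSucc p"]) simp
qed

lemma total_rec_comp:
  assumes "total_rec F" "total_rec G"
  shows "total_rec (\<lambda>f x. F f (G f x))"
proof -
  obtain p where "\<forall>f x. run f p x = Some (F f x)" using assms(1) by (rule total_recE)
  moreover obtain q where "\<forall>f x. run f q x = Some (G f x)" using assms(2) by (rule total_recE)
  ultimately show ?thesis by (intro total_recI[of "PComp p q"]) simp
qed

lemma total_rec_Suc [rec_intros]: "total_rec F \<Longrightarrow> total_rec (\<lambda>f x. Suc (F f x))"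
  by (rule total_rec_comp[of "\<lambda>f x. Suc x"]) (auto intro: total_recI[of PSucc])

lemma total_rec_pfst [rec_intros]: "total_rec F \<Longrightarrow> total_rec (\<lambda>f x. pfst (F f x))"
  by (rule total_rec_comp[of "\<lambda>f x. pfst x"]) (auto intro: total_recI[of PFst])

lemma total_rec_psnd [rec_intros]: "total_rec F \<Longrightarrow> total_rec (\<lambda>f x. psnd (F f x))"
  by (rule total_rec_comp[of "\<lambda>f x. psnd x"]) (auto intro: total_recI[of PSnd])

lemma total_rec_query [rec_intros]: "total_rec F \<Longrightarrow> total_rec (\<lambda>f x. f (F f x))"
  by (rule total_rec_comp[of "\<lambda>f x. f x"]) (auto intro: total_recI[of PQuery])

lemma total_rec_pair [rec_intros]:
  assumes "total_rec F" "total_rec G"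
  shows "total_rec (\<lambda>f x. prod_encode (F f x, G f x))"
proof -
  obtain p where "\<forall>f x. run f p x = Some (F f x)" using assms(1) by (rule total_recE)
  moreover obtain q where "\<forall>f x. run f q x = Some (G f x)" using assms(2) by (rule total_recE)
  ultimately show ?thesis by (intro total_recI[of "PPair p q"]) simp
qed

lemma total_rec_rec_nat [rec_intros]:
  assumes "total_rec F" "total_rec (\<lambda>f w. G f (pfst w) (pfst (psnd w)) (psnd (psnd w)))" "total_rec N"
  shows "total_rec (\<lambda>f x. rec_nat (F f x) (G f x) (N f x))"
proof -
  obtain p where p: "\<forall>f x. run f p x = Some (F f x)" using assms(1) by (rule total_recE)
  obtain q where q: "\<forall>f w. run f q w = Some (G f (pfst w) (pfst (psnd w)) (psnd (psnd w)))"
    using assms(2) by (rule total_recE)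
  obtain r where r: "\<forall>f x. run f r x = Some (N f x)" using assms(3) by (rule total_recE)
  have "run f (PPrec p q) (prod_encode (x, n)) = Some (rec_nat (F f x) (G f x) n)" for f x n
    by (induction n) (simp_all add: p q)
  then show ?thesis
    by (intro total_recI[of "PComp (PPrec p q) (PPair (PPair PFst PSnd) r)"]) (simp add: r)
qed

lemma total_rec_pred [rec_intros]:
  assumes "total_rec F"
  shows "total_rec (\<lambda>f x. F f x - 1)"
proof -
  have "rec_nat 0 (\<lambda>m y. m) n = n - 1" for n by (cases n) auto
  moreover have "total_rec (\<lambda>f x. rec_nat 0 (\<lambda>m y. m) (F f x))" by (intro rec_intros assms)
  ultimately show ?thesis by simp
qed

lemma total_rec_add [rec_intros]:
  assumes "total_rec F" "total_rec G"
  shows "total_rec (\<lambda>f x. F f x + G f x)"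
proof -
  have "rec_nat a (\<lambda>m y. Suc y) n = a + n" for a n by (induction n) auto
  moreover have "total_rec (\<lambda>f x. rec_nat (F f x) (\<lambda>m y. Suc y) (G f x))"
    by (intro rec_intros assms)
  ultimately show ?thesis by simp
qed

lemma total_rec_diff [rec_intros]:
  assumes "total_rec F" "total_rec G"
  shows "total_rec (\<lambda>f x. F f x - G f x)"
proof -
  have "rec_nat a (\<lambda>m y. y - 1) n = a - n" for a n by (induction n) auto
  moreover have "total_rec (\<lambda>f x. rec_nat (F f x) (\<lambda>m y. y - 1) (G f x))"
    by (intro rec_intros assms)
  ultimately show ?thesis by simp
qed

lemma total_rec_if [rec_intros]:
  assumes "decidable P" "total_rec F" "total_rec G"
  shows "total_rec (\<lambda>f x. if P f x then F f x else G f x)"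
proof -
  have "rec_nat b (\<lambda>m y. a) (if Q then 1 else 0) = (if Q then a else b)" for a b :: nat and Q by simp
  moreover have "total_rec (\<lambda>f x. rec_nat (G f x) (\<lambda>m y. F f x) (if P f x then 1 else 0))"
    by (intro total_rec_rec_nat assms(3) total_rec_comp[OF assms(2)] total_rec_pfst total_rec_id
        assms(1)[unfolded decidable_def])
  ultimately show ?thesis by simp
qed

lemma decidable_eq_0:
  assumes "total_rec F"
  shows "decidable (\<lambda>f x. F f x = 0)"
proof -
  have "total_rec (\<lambda>f x. 1 - F f x)" by (intro rec_intros assms)
  moreover have "1 - n = (if n = 0 then 1 else 0)" for n :: nat by simp
  ultimately show ?thesis by (simp add: decidable_def)
qed

lemma decidable_eq [rec_intros]:
  assumes "total_rec F" "total_rec G"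
  shows "decidable (\<lambda>f x. F f x = G f x)"
proof -
  have "decidable (\<lambda>f x. (F f x - G f x) + (G f x - F f x) = 0)"
    by (intro decidable_eq_0 rec_intros assms)
  moreover have "(a - b) + (b - a) = 0 \<longleftrightarrow> a = b" for a b :: nat by auto
  ultimately show ?thesis by simp
qed

lemma decidable_less [rec_intros]:
  assumes "total_rec F" "total_rec G"
  shows "decidable (\<lambda>f x. F f x < G f x)"
proof -
  have "decidable (\<lambda>f x. Suc (F f x) - G f x = 0)" by (intro decidable_eq_0 rec_intros assms)
  moreover have "Suc a - b = 0 \<longleftrightarrow> a < b" for a b :: nat by auto
  ultimately show ?thesis by simp
qed

lemma decidable_not [rec_intros]:
  assumes "decidable P"
  shows "decidable (\<lambda>f x. \<not> P f x)"
proof -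
  have "total_rec (\<lambda>f x. if P f x then 0 else 1)" by (intro rec_intros assms)
  moreover have "(if \<not> Q then 1 else 0) = (if Q then 0 else 1 :: nat)" for Q by simp
  ultimately show ?thesis by (simp only: decidable_def)
qed

lemma decidable_conj [rec_intros]:
  assumes "decidable P" "decidable Q"
  shows "decidable (\<lambda>f x. P f x \<and> Q f x)"
proof -
  have "total_rec (\<lambda>f x. if P f x then if Q f x then 1 else 0 else 0)" by (intro rec_intros assms)
  moreover have "(if A \<and> B then 1 else 0) = (if A then if B then 1 else 0 else 0 :: nat)" for A B by simp
  ultimately show ?thesis by (simp only: decidable_def)
qed

lemma decidable_comp:
  assumes "decidable P" "total_rec F"
  shows "decidable (\<lambda>f x. P f (F f x))"
  using total_rec_comp[OF assms(1)[unfolded decidable_def] assms(2)] by (simp add: decidable_def)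

lemma decidable_ball [rec_intros]:
  assumes "total_rec N" "decidable (\<lambda>f w. P f (pfst w) (psnd w))"
  shows "decidable (\<lambda>f x. \<forall>m<N f x. P f x m)"
proof -
  have "decidable (\<lambda>f w. P f (pfst w) (pfst (psnd w)))"
    using decidable_comp[OF assms(2), of "\<lambda>f w. prod_encode (pfst w, pfst (psnd w))"]
    by (simp add: rec_intros)
  then have "total_rec (\<lambda>f x. rec_nat 1 (\<lambda>m y. if P f x m then y else 0) (N f x))"
    by (intro rec_intros assms(1))
  moreover have "rec_nat 1 (\<lambda>m y. if Q m then y else 0) n = (if \<forall>m<n. Q m then 1 else 0 :: nat)" for Q n
    by (induction n) (auto simp: less_Suc_eq)
  ultimately show ?thesis by (simp add: decidable_def)
qed

text \<open>The shift by \<open>Suc\<close> frees 0 to mean that no witness exists, the convention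
  of \<open>opt_code\<close>. In the recursion 0 means still searching, and a nonzero value is
  kept.\<close>

lemma total_rec_bounded_Least:
  assumes "total_rec N" "decidable (\<lambda>f w. P f (pfst w) (psnd w))"
  shows "total_rec (\<lambda>f x. if \<exists>n<N f x. P f x n then Suc (LEAST n. P f x n) else 0)"
proof -
  have "decidable (\<lambda>f w. P f (pfst w) (pfst (psnd w)))"
    using decidable_comp[OF assms(2), of "\<lambda>f w. prod_encode (pfst w, pfst (psnd w))"]
    by (simp add: rec_intros)
  then have "total_rec (\<lambda>f x. rec_nat 0
      (\<lambda>m y. if y = 0 then if P f x m then Suc m else 0 else y) (N f x))"
    by (intro rec_intros assms(1))
  moreover have "rec_nat 0 (\<lambda>m y. if y = 0 then if Q m then Suc m else 0 else y) n
      = (if \<exists>m<n. Q m then Suc (LEAST m. Q m) else 0)" for Q n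
  proof (induction n)
    case (Suc n)
    have "(LEAST m. Q m) = n" if "Q n" "\<not> (\<exists>m<n. Q m)"
      using that by (intro Least_equality) (auto simp: not_less[symmetric])
    with Suc show ?case by (auto simp: less_Suc_eq)
  qed simp
  ultimately show ?thesis by simp
qed

lemma total_rec_comp2:
  assumes "total_rec (\<lambda>f w. H f (pfst w) (psnd w))" "total_rec F" "total_rec G"
  shows "total_rec (\<lambda>f x. H f (F f x) (G f x))"
  using total_rec_comp[OF assms(1) total_rec_pair[OF assms(2,3)]] by simp

lemma total_rec_mod_2 [rec_intros]:
  assumes "total_rec F"
  shows "total_rec (\<lambda>f x. F f x mod 2)"
proof -
  have "rec_nat 0 (\<lambda>m y. 1 - y) n = n mod 2" for n :: nat
    by (induction n) (simp_all, presburger)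
  moreover have "total_rec (\<lambda>f x. rec_nat 0 (\<lambda>m y. 1 - y) (F f x))" by (intro rec_intros assms)
  ultimately show ?thesis by simp
qed

lemma total_rec_div_2 [rec_intros]:
  assumes "total_rec F"
  shows "total_rec (\<lambda>f x. F f x div 2)"
proof -
  have "rec_nat 0 (\<lambda>m y. y + m mod 2) n = n div 2" for n :: nat
    by (induction n) (simp_all, presburger)
  moreover have "total_rec (\<lambda>f x. rec_nat 0 (\<lambda>m y. y + m mod 2) (F f x))" by (intro rec_intros assms)
  ultimately show ?thesis by simp
qed

lemma decidable_even [rec_intros]: "total_rec F \<Longrightarrow> decidable (\<lambda>f x. even (F f x))"
  unfolding even_iff_mod_2_eq_zero by (intro rec_intros)

lemma total_rec_fun_cons [rec_intros]:
  assumes "total_rec A" "total_rec (\<lambda>f w. B f (pfst w) (psnd w))" "total_rec F"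
  shows "total_rec (\<lambda>f x. fun_cons (A f x) (B f x) (F f x))"
proof -
  have "total_rec (\<lambda>f x. if F f x = 0 then A f x else B f x (F f x - 1))"
    by (intro rec_intros assms(1,3) total_rec_comp2[OF assms(2)])
  moreover have "fun_cons i g n = (if n = 0 then i else g (n - 1))" for i g n
    by (cases n) (auto simp: fun_cons_def)
  ultimately show ?thesis by simp
qed

text \<open>As the test is decidable, every value that \<open>PMu\<close> inspects is defined, so
  the search finds the true minimum.\<close>

lemma partial_rec_Least:
  assumes "decidable (\<lambda>f w. P f (pfst w) (psnd w))"
  shows "partial_rec (\<lambda>f x. if \<exists>n. P f x n then Some (LEAST n. P f x n) else None)"
proof -
  have "total_rec (\<lambda>f w. if P f (pfst w) (psnd w) then 0 else 1)" by (intro rec_intros assms)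
  then obtain p where p: "\<forall>f w. run f p w = Some (if P f (pfst w) (psnd w) then 0 else 1)"
    by (rule total_recE)
  have "run f (PMu p) x = (if \<exists>n. P f x n then Some (LEAST n. P f x n) else None)" for f x
    by (simp add: p Let_def)
  then show ?thesis unfolding partial_rec_def by blast
qed

lemma partial_rec_map:
  assumes "partial_rec G" "total_rec (\<lambda>f w. H f (pfst w) (psnd w))"
  shows "partial_rec (\<lambda>f x. map_option (H f x) (G f x))"
proof -
  obtain p where p: "\<And>f. run f p = G f" using assms(1) unfolding partial_rec_def by blast
  obtain q where q: "\<forall>f w. run f q w = Some (H f (pfst w) (psnd w))" using assms(2) by (rule total_recE)
  have "run f (PComp q (PPair (PPair PFst PSnd) p)) x = map_option (H f x) (G f x)" for f x
    by (cases "G f x") (simp_all add: p q)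
  then show ?thesis unfolding partial_rec_def by blast
qed

section \<open>Coding of finite sequences\<close>

definition entry :: "nat \<Rightarrow> nat \<Rightarrow> nat" where
  "entry a i = pfst (((\<lambda>y. psnd y) ^^ i) a)"

text \<open>Iterated pairing lets every number code an infinite sequence, so decoding is total; the
  length of a string is stored apart from its entries, as in \<open>prefix\<close>.\<close>

lemma ex_entry: "\<exists>a. \<forall>i<k. entry a i = f i"
proof (induction k arbitrary: f)
  case (Suc k)
  obtain a where a: "\<forall>i<k. entry a i = f (Suc i)" using Suc[of "\<lambda>i. f (Suc i)"] by blast
  have "entry (prod_encode (f 0, a)) i = f i" if "i < Suc k" for i
    using a that by (cases i) (auto simp: entry_def funpow_Suc_right simp del: funpow.simps(2))
  then show ?case by blast
qed simp

lemma total_rec_entry [rec_intros]: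
  assumes "total_rec F" "total_rec G"
  shows "total_rec (\<lambda>f x. entry (F f x) (G f x))"
proof -
  have "((\<lambda>y. psnd y) ^^ i) a = rec_nat a (\<lambda>_ y. psnd y) i" for i a by (induction i) auto
  moreover have "total_rec (\<lambda>f x. pfst (rec_nat (F f x) (\<lambda>_ y. psnd y) (G f x)))"
    by (intro rec_intros assms)
  ultimately show ?thesis by (simp add: entry_def)
qed

section \<open>Finite approximations of computations\<close>

text \<open>
  \<^const>\<open>run\<close> with a partial oracle \<open>\<alpha>\<close> and unbounded search restricted to values below \<open>b\<close>. With a
  decidable oracle this always terminates, hence it is a substitute for bounding the running time.
\<close>

primrec approx :: "(nat \<Rightarrow> nat option) \<Rightarrow> nat \<Rightarrow> prog \<Rightarrow> nat \<Rightarrow> nat option" where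
  "approx \<alpha> b PZero = (\<lambda>x. Some 0)"
| "approx \<alpha> b PSucc = (\<lambda>x. Some (Suc x))"
| "approx \<alpha> b PFst = (\<lambda>x. Some (pfst x))"
| "approx \<alpha> b PSnd = (\<lambda>x. Some (psnd x))"
| "approx \<alpha> b PQuery = \<alpha>"
| "approx \<alpha> b (PPair c d) =
     (\<lambda>x. Option.bind (approx \<alpha> b c x) (\<lambda>y. Option.bind (approx \<alpha> b d x) (\<lambda>z. Some (prod_encode (y, z)))))"
| "approx \<alpha> b (PComp c d) = (\<lambda>x. Option.bind (approx \<alpha> b d x) (approx \<alpha> b c))"
| "approx \<alpha> b (PPrec c d) =
     (\<lambda>x. rec_nat (approx \<alpha> b c (pfst x))
        (\<lambda>m r. Option.bind r (\<lambda>y. approx \<alpha> b d (prod_encode (pfst x, prod_encode (m, y)))))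
        (psnd x))"
| "approx \<alpha> b (PMu c) =
     (\<lambda>x. let P = (\<lambda>n. approx \<alpha> b c (prod_encode (x, n)) = Some 0 \<and>
                       (\<forall>m<n. approx \<alpha> b c (prod_encode (x, m)) \<noteq> None))
          in if \<exists>n<b. P n then Some (LEAST n. P n) else None)"

text \<open>A zero at \<open>n\<close> with positive values before it involves finitely many values
  and survives when further values become defined, which is not apparent for the
  \<open>LEAST\<close> in \<open>PMu\<close>. Soundness and completeness of \<open>approx\<close>
  both pass through this form.\<close>

lemma Least_first_zero:
  fixes g :: "nat \<Rightarrow> nat option"
  assumes "g n = Some 0" "\<forall>m<n. \<exists>y. g m = Some (Suc y)"
  shows "(LEAST n. g n = Some 0 \<and> (\<forall>m<n. g m \<noteq> None)) = n"
proof (intro Least_equality)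
  show "g n = Some 0 \<and> (\<forall>m<n. g m \<noteq> None)" using assms by force
  show "n \<le> k" if "g k = Some 0 \<and> (\<forall>m<k. g m \<noteq> None)" for k
    using that assms(2) by (metis not_less option.inject nat.distinct(1))
qed

lemma first_zero:
  fixes g :: "nat \<Rightarrow> nat option"
  assumes "\<exists>n. g n = Some 0 \<and> (\<forall>m<n. g m \<noteq> None)"
  defines "n \<equiv> (LEAST n. g n = Some 0 \<and> (\<forall>m<n. g m \<noteq> None))"
  shows "g n = Some 0" "\<forall>m<n. \<exists>y. g m = Some (Suc y)"
proof -
  have n: "g n = Some 0 \<and> (\<forall>m<n. g m \<noteq> None)" unfolding n_def by (rule LeastI_ex) fact
  then show "g n = Some 0" by blast
  show "\<forall>m<n. \<exists>y. g m = Some (Suc y)"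
  proof (intro allI impI)
    fix m assume "m < n"
    moreover from this have "g m \<noteq> Some 0"
      using n not_less_Least[of m "\<lambda>n. g n = Some 0 \<and> (\<forall>m<n. g m \<noteq> None)", folded n_def]
      by (meson less_trans)
    ultimately show "\<exists>y. g m = Some (Suc y)" using n by (metis not0_implies_Suc option.exhaust)
  qed
qed

text \<open>The partial oracle answers only correctly and the bound \<open>b\<close> only suppresses
  results; neither can alter one.\<close>

lemma approx_sound:
  assumes "\<And>q y. \<alpha> q = Some y \<Longrightarrow> f q = y"
  shows "approx \<alpha> b p x = Some y \<Longrightarrow> run f p x = Some y"
proof (induction p arbitrary: x y)
  case PQuery
  then show ?case using assms by simp
next
  case (PPair c d)
  then show ?case by (auto simp: bind_eq_Some_conv)
next
  case (PComp c d)
  then show ?case by (force simp: bind_eq_Some_conv)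
next
  case (PPrec c d)
  have "rec_nat (approx \<alpha> b c x1) (\<lambda>m r. Option.bind r (\<lambda>y. approx \<alpha> b d (prod_encode (x1, prod_encode (m, y))))) n = Some y
    \<Longrightarrow> rec_nat (run f c x1) (\<lambda>m r. Option.bind r (\<lambda>y. run f d (prod_encode (x1, prod_encode (m, y))))) n = Some y"
    for x1 n y
  proof (induction n arbitrary: y)
    case 0
    then show ?case using PPrec.IH(1) by simp
  next
    case (Suc n)
    then show ?case using PPrec.IH(2) by (force simp: bind_eq_Some_conv)
  qed
  with PPrec.prems show ?case by simp
next
  case (PMu c)
  let ?g = "\<lambda>n. approx \<alpha> b c (prod_encode (x, n))"
  let ?h = "\<lambda>n. run f c (prod_encode (x, n))"
  have ex: "\<exists>n. ?g n = Some 0 \<and> (\<forall>m<n. ?g m \<noteq> None)"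
    and y: "y = (LEAST n. ?g n = Some 0 \<and> (\<forall>m<n. ?g m \<noteq> None))"
    using PMu.prems by (auto simp: Let_def split: if_splits)
  have "?h y = Some 0" using first_zero(1)[OF ex] PMu.IH unfolding y by blast
  moreover have "\<forall>m<y. \<exists>z. ?h m = Some (Suc z)" using first_zero(2)[OF ex] PMu.IH unfolding y by blast
  ultimately show ?case using Least_first_zero[of ?h y]
    by (simp add: Let_def) (metis option.distinct(1))
qed simp_all

text \<open>A halting computation depends on finitely many queries and searches. Each is correct
  from some \<open>k\<close> on, and finitely many such thresholds combine.\<close>

lemma approx_complete:
  assumes "\<And>q. eventually (\<lambda>k. \<alpha> k q = Some (f q)) sequentially"
  shows "run f p x = Some y \<Longrightarrow> eventually (\<lambda>k. approx (\<alpha> k) k p x = Some y) sequentially"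
proof (induction p arbitrary: x y)
  case PQuery
  then show ?case using assms[of x] by simp
next
  case (PPair c d)
  then obtain u v where uv: "run f c x = Some u" "run f d x = Some v" "y = prod_encode (u, v)"
    by (auto simp: bind_eq_Some_conv)
  show ?case using PPair.IH(1)[OF uv(1)] PPair.IH(2)[OF uv(2)]
    by eventually_elim (simp add: uv(3))
next
  case (PComp c d)
  then obtain v where v: "run f d x = Some v" "run f c v = Some y"
    by (auto simp: bind_eq_Some_conv)
  show ?case using PComp.IH(2)[OF v(1)] PComp.IH(1)[OF v(2)] by eventually_elim simp
next
  case (PPrec c d)
  have "rec_nat (run f c x1) (\<lambda>m r. Option.bind r (\<lambda>y. run f d (prod_encode (x1, prod_encode (m, y))))) n = Some y
    \<Longrightarrow> eventually (\<lambda>k. rec_nat (approx (\<alpha> k) k c x1) (\<lambda>m r. Option.bind r (\<lambda>y. approx (\<alpha> k) k d (prod_encode (x1, prod_encode (m, y))))) n = Some y) sequentially"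
    for x1 n y
  proof (induction n arbitrary: y)
    case 0
    then show ?case using PPrec.IH(1) by simp
  next
    case (Suc n)
    then obtain z where z: "rec_nat (run f c x1) (\<lambda>m r. Option.bind r (\<lambda>y. run f d (prod_encode (x1, prod_encode (m, y))))) n = Some z"
      "run f d (prod_encode (x1, prod_encode (n, z))) = Some y"
      by (auto simp: bind_eq_Some_conv)
    show ?case using Suc.IH[OF z(1)] PPrec.IH(2)[OF z(2)] by eventually_elim simp
  qed
  with PPrec.prems show ?case by simp
next
  case (PMu c)
  let ?g = "\<lambda>k n. approx (\<alpha> k) k c (prod_encode (x, n))"
  let ?h = "\<lambda>n. run f c (prod_encode (x, n))"
  have ex: "\<exists>n. ?h n = Some 0 \<and> (\<forall>m<n. ?h m \<noteq> None)"
    and y: "y = (LEAST n. ?h n = Some 0 \<and> (\<forall>m<n. ?h m \<noteq> None))"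
    using PMu.prems by (auto simp: Let_def split: if_splits)
  have 0: "?h y = Some 0" using first_zero(1)[OF ex] unfolding y .
  have S: "\<forall>m<y. \<exists>z. ?h m = Some (Suc z)" using first_zero(2)[OF ex] unfolding y .
  have "eventually (\<lambda>k. \<forall>m\<in>{..<y}. \<exists>z. ?g k m = Some (Suc z)) sequentially"
  proof (rule eventually_ball_finite)
    show "\<forall>m\<in>{..<y}. eventually (\<lambda>k. \<exists>z. ?g k m = Some (Suc z)) sequentially"
    proof
      fix m assume "m \<in> {..<y}"
      then obtain z where "?h m = Some (Suc z)" using S by blast
      from PMu.IH[OF this] show "eventually (\<lambda>k. \<exists>z. ?g k m = Some (Suc z)) sequentially"
        by eventually_elim blast
    qed
  qed simp
  \<comment> \<open>The search bound \<open>k\<close> has to exceed the result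
    \<open>y\<close>.\<close>
  then show ?case using PMu.IH[OF 0] eventually_gt_at_top[of y]
  proof eventually_elim
    case (elim k)
    then have "(LEAST n. ?g k n = Some 0 \<and> (\<forall>m<n. ?g k m \<noteq> None)) = y"
      by (intro Least_first_zero) auto
    moreover have "\<exists>n<k. ?g k n = Some 0 \<and> (\<forall>m<n. ?g k m \<noteq> None)"
      using elim by (intro exI[of _ y]) auto
    ultimately show ?case by (simp add: Let_def)
  qed
qed simp_all

text \<open>Makes divergence a testable value: nonzero codes are results, recovered by subtracting
  1.\<close>

primrec opt_code :: "nat option \<Rightarrow> nat" where
  "opt_code None = 0"
| "opt_code (Some y) = Suc y"

lemma opt_code_eq_0 [simp]: "opt_code r = 0 \<longleftrightarrow> r = None"
  by (cases r) auto

lemma opt_code_bind: "opt_code (Option.bind r h) = (if opt_code r = 0 then 0 else opt_code (h (opt_code r - 1)))"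
  by (cases r) auto

text \<open>Bounded searches terminate, so even failure is computable. The induction is on the fixed
  program \<open>p\<close>: each program gets an evaluator of its own.\<close>

lemma total_rec_approx:
  assumes "total_rec (\<lambda>f w. opt_code (\<alpha> f (pfst w) (psnd w)))" "total_rec b"
  shows "total_rec (\<lambda>f w. opt_code (approx (\<alpha> f (pfst w)) (b f (pfst w)) p (psnd w)))"
proof (induction p)
  case (PPair c d)
  show ?case unfolding approx.simps opt_code_bind opt_code.simps
    by (intro rec_intros PPair)
next
  case (PComp c d)
  have "total_rec (\<lambda>f w. opt_code (approx (\<alpha> f (pfst w)) (b f (pfst w)) c
    (opt_code (approx (\<alpha> f (pfst w)) (b f (pfst w)) d (psnd w)) - 1)))"
    using total_rec_comp[OF PComp(1), of "\<lambda>f w. prod_encode (pfst w, opt_code (approx (\<alpha> f (pfst w)) (b f (pfst w)) d (psnd w)) - 1)"]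
    PComp(2) by (simp add: rec_intros)
  then show ?case unfolding approx.simps opt_code_bind
    by (intro rec_intros PComp(2))
next
  case (PPrec c d)
  let ?C = "\<lambda>f w. opt_code (approx (\<alpha> f (pfst w)) (b f (pfst w)) c (psnd w))"
  let ?D = "\<lambda>f w. opt_code (approx (\<alpha> f (pfst w)) (b f (pfst w)) d (psnd w))"
  have "opt_code (rec_nat (approx (\<alpha> f s) (b f s) c x1) (\<lambda>m r. Option.bind r (\<lambda>y. approx (\<alpha> f s) (b f s) d (prod_encode (x1, prod_encode (m, y))))) n)
    = rec_nat (?C f (prod_encode (s, x1))) (\<lambda>m r. if r = 0 then 0 else ?D f (prod_encode (s, prod_encode (x1, prod_encode (m, r - 1))))) n" for f s x1 n
    by (induction n) (simp_all add: opt_code_bind)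
  moreover have "total_rec (\<lambda>f w. rec_nat (?C f (prod_encode (pfst w, pfst (psnd w)))) (\<lambda>m r. if r = 0 then 0 else ?D f (prod_encode (pfst w, prod_encode (pfst (psnd w), prod_encode (m, r - 1))))) (psnd (psnd w)))"
    by (intro rec_intros total_rec_comp[OF PPrec(1)] total_rec_comp[OF PPrec(2)])
  ultimately show ?case by (simp del: prod_encode_inverse)
next
  case (PMu c)
  let ?P = "\<lambda>f w n. approx (\<alpha> f (pfst w)) (b f (pfst w)) c (prod_encode (psnd w, n)) = Some 0 \<and>
     (\<forall>m<n. approx (\<alpha> f (pfst w)) (b f (pfst w)) c (prod_encode (psnd w, m)) \<noteq> None)"
  let ?A = "\<lambda>f w n. opt_code (approx (\<alpha> f (pfst w)) (b f (pfst w)) c (prod_encode (psnd w, n)))"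
  have A: "total_rec (\<lambda>f x. ?A f (F f x) (N f x))" if "total_rec F" "total_rec N" for F N
    using total_rec_comp[OF PMu, of "\<lambda>f x. prod_encode (pfst (F f x), prod_encode (psnd (F f x), N f x))"] that
    by (simp add: rec_intros)
  have "decidable (\<lambda>f w. ?A f (pfst w) (psnd w) = 1 \<and> (\<forall>m<psnd w. \<not> ?A f (pfst w) m = 0))"
    by (intro rec_intros A)
  moreover have "opt_code r = 1 \<longleftrightarrow> r = Some 0" for r by (cases r) auto
  ultimately have "decidable (\<lambda>f w. ?P f (pfst w) (psnd w))" by simp
  then have "total_rec (\<lambda>f w. if \<exists>n<b f (pfst w). ?P f w n then Suc (LEAST n. ?P f w n) else 0)"
    by (intro total_rec_bounded_Least total_rec_comp[OF assms(2)] total_rec_pfst total_rec_id)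
  moreover have "opt_code (if Q then Some n else None) = (if Q then Suc n else 0)" for Q n by simp
  ultimately show ?case by (simp only: approx.simps Let_def)
qed (use assms in \<open>simp_all, (intro rec_intros)+\<close>)

section \<open>Coded finite strings as partial oracles\<close>

definition prefix :: "nat \<Rightarrow> nat \<Rightarrow> nat option" where
  "prefix s q = (if q < pfst s then Some (entry (psnd s) q) else None)"

definition matches :: "nat \<Rightarrow> (nat \<Rightarrow> nat) \<Rightarrow> bool" where
  "matches s f \<longleftrightarrow> (\<forall>q<pfst s. entry (psnd s) q = f q)"

definition overwrite :: "nat \<Rightarrow> (nat \<Rightarrow> nat) \<Rightarrow> nat \<Rightarrow> nat" where
  "overwrite s f q = (if q < pfst s then entry (psnd s) q else f q)"

lemma ex_matches: "\<exists>s. pfst s = k \<and> matches s f"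
proof -
  obtain a where "\<forall>i<k. entry a i = f i" using ex_entry by blast
  then show ?thesis by (intro exI[of _ "prod_encode (k, a)"]) (simp add: matches_def)
qed

lemma ex_matches_sequence: "\<exists>c. \<forall>k. pfst (c k) = k \<and> matches (c k) f"
  by (intro choice allI ex_matches)

lemma matches_overwrite: "matches s (overwrite s f)"
  by (simp add: matches_def overwrite_def)

lemma total_rec_prefix [rec_intros]:
  assumes "total_rec F" "total_rec G"
  shows "total_rec (\<lambda>f x. opt_code (prefix (F f x) (G f x)))"
proof -
  have "opt_code (prefix s q) = (if q < pfst s then Suc (entry (psnd s) q) else 0)" for s q
    by (simp add: prefix_def)
  moreover have "total_rec (\<lambda>f x. if G f x < pfst (F f x) then Suc (entry (psnd (F f x)) (G f x)) else 0)"
    by (intro rec_intros assms)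
  ultimately show ?thesis by simp
qed

lemma decidable_matches [rec_intros]:
  assumes "total_rec F" "total_rec (\<lambda>f w. G f (pfst w) (psnd w))"
  shows "decidable (\<lambda>f x. matches (F f x) (G f x))"
  unfolding matches_def
  by (intro rec_intros total_rec_comp[OF assms(1)] total_rec_comp2[OF assms(2)] assms(1))

lemma countable_prog: "countable (UNIV :: prog set)"
  unfolding countable_def by (rule exI[of _ prog_encode], rule inj_on_inverseI[of _ prog_decode]) simp

section \<open>Turing reducibility\<close>

definition turing_le :: "(nat \<Rightarrow> nat) \<Rightarrow> (nat \<Rightarrow> nat) \<Rightarrow> bool" where
  "turing_le f g \<longleftrightarrow> (\<exists>p. run g p = Some \<circ> f)"

lemma turing_le_trans: "turing_le f g \<Longrightarrow> turing_le g h \<Longrightarrow> turing_le f h"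
  unfolding turing_le_def by (metis run_oracle_subst)

lemma turing_le_total_rec: "total_rec F \<Longrightarrow> turing_le (F f) f"
  unfolding turing_le_def total_rec_def by blast

lemma oracle_free_oracle_subst: "oracle_free e \<Longrightarrow> oracle_free (oracle_subst e p)"
  by (induction p) auto

lemma run_oracle_subst_PZero: "run f (oracle_subst PZero p) = run (\<lambda>_. 0) p"
  by (rule run_oracle_subst) auto

text \<open>Replacing each query by \<open>PZero\<close> turns a program with the zero oracle into
  an oracle-free one with the same values.\<close>

lemma computable_iff: "computable f \<longleftrightarrow> turing_le f (\<lambda>_. 0)"
  unfolding computable_def turing_le_def
  by (metis oracle_free_oracle_subst oracle_free.simps(1) run_oracle_subst_PZero)

lemma computable_imp_turing_le: "computable f \<Longrightarrow> turing_le f g"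
  unfolding computable_iff unfolding turing_le_def by (metis run_oracle_subst_PZero)

lemma countable_turing_cone: "countable {g. turing_le g f}"
proof (rule countable_subset)
  show "{g. turing_le g f} \<subseteq> (\<lambda>p x. the (run f p x)) ` UNIV"
    
  proof
    fix g assume "g \<in> {g. turing_le g f}"
    then obtain p where "run f p = Some \<circ> g" unfolding turing_le_def by blast
    then have "g = (\<lambda>x. the (run f p x))" by simp
    then show "g \<in> (\<lambda>p x. the (run f p x)) ` UNIV" by blast
  qed
  show "countable ((\<lambda>p x. the (run f p x)) ` UNIV)" by (intro countable_image countable_prog)
qed

text \<open>One \<open>r\<close> works for all oracles, so this serves Turing reducibility and the
  uniform Medvedev reductions alike. Running both \<open>p\<close> and \<open>q\<close> at
  \<open>x div 2\<close> is harmless, since both are total whenever the conclusion is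
  claimed.\<close>

lemma run_join_ex:
  "\<exists>r. \<forall>f a b. run f p = Some \<circ> a \<longrightarrow> run f q = Some \<circ> b \<longrightarrow> run f r = Some \<circ> fun_join a b"
proof -
  have "total_rec (\<lambda>f x. x div 2)" by (intro rec_intros)
  then obtain h where h: "\<forall>f x. run f h x = Some (x div 2)" by (rule total_recE)
  have "total_rec (\<lambda>f w. if even (pfst w) then pfst (psnd w) else psnd (psnd w))" by (intro rec_intros)
  then obtain s where s: "\<forall>f w. run f s w = Some (if even (pfst w) then pfst (psnd w) else psnd (psnd w))"
    by (rule total_recE)
  show ?thesis
    by (rule exI[of _ "PComp s (PPair (PPair PFst PSnd) (PPair (PComp p h) (PComp q h)))"])
      (auto simp: h s fun_join_def fun_eq_iff)
qed

lemma turing_le_fun_join: "turing_le a f \<Longrightarrow> turing_le b f \<Longrightarrow> turing_le (fun_join a b) f"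
  unfolding turing_le_def using run_join_ex by metis

lemma turing_le_overwrite: "turing_le (overwrite s f) f"
  unfolding overwrite_def by (rule turing_le_total_rec) (intro rec_intros)

section \<open>Cone avoidance by finite extensions\<close>

lemma dense_sequence:
  fixes R :: "nat \<Rightarrow> (nat \<Rightarrow> nat) \<Rightarrow> bool"
  assumes dense: "\<And>n k h. \<exists>k'\<ge>k. \<exists>h'. (\<forall>i<k. h' i = h i) \<and> (\<forall>f. (\<forall>i<k'. f i = h' i) \<longrightarrow> R n f)"
  shows "\<exists>f. \<forall>n. R n f"
proof -
  \<comment> \<open>A Baire category argument: a pair stands for a finite condition, of whose second
    component only the values below the first count. Step \<open>n\<close> strictly lengthens the
    condition and forces \<open>R n\<close>.\<close>
  define Q where "Q n x y \<longleftrightarrow> fst x < fst y \<and> (\<forall>i<fst x. snd y i = snd x i) \<and>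
    (\<forall>f. (\<forall>i<fst y. f i = snd y i) \<longrightarrow> R n f)" for n and x y :: "nat \<times> (nat \<Rightarrow> nat)"
  have "\<exists>y. Q n x y" for n x
  proof -
    obtain k' h' where "k' \<ge> Suc (fst x)" "\<forall>i<Suc (fst x). h' i = snd x i"
      "\<forall>f. (\<forall>i<k'. f i = h' i) \<longrightarrow> R n f"
      using dense[of "Suc (fst x)" "snd x" n] by blast
    then show ?thesis unfolding Q_def by (intro exI[of _ "(k', h')"]) auto
  qed
  then obtain y where y: "\<And>n. Q n (y n) (y (Suc n))"
    using dependent_nat_choice[of "\<lambda>_ _. True" Q] by auto
  have mono: "fst (y n) \<le> fst (y (n + m)) \<and> (\<forall>i<fst (y n). snd (y (n + m)) i = snd (y n) i)" for n m
  proof (induction m)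
    case (Suc m)
    then show ?case using y[of "n + m"] unfolding Q_def by force
  qed simp
  have len: "n \<le> fst (y n)" for n
  proof (induction n)
    case (Suc n)
    then show ?case using y[of n] unfolding Q_def by force
  qed simp
  \<comment> \<open>By \<open>len\<close>, condition number \<open>Suc i\<close> already fixes the
    value at \<open>i\<close>.\<close>
  define f where "f i = snd (y (Suc i)) i" for i
  have f: "f i = snd (y n) i" if "i < fst (y n)" for i n
  proof (cases "Suc i \<le> n")
    case True
    then obtain m where "n = Suc i + m" using le_Suc_ex by blast
    then show ?thesis using mono[of "Suc i" m] len[of "Suc i"] by (simp add: f_def)
  next
    case False
    then obtain m where "Suc i = n + m" by (metis le_Suc_ex nat_le_linear)
    then show ?thesis using mono[of n m] that by (simp add: f_def)
  qed
  have "R n f" for n using y[of n] f[of _ "Suc n"] unfolding Q_def by blast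
  then show ?thesis by blast
qed

lemma approx_prefix_sound:
  "matches s f \<Longrightarrow> approx (prefix s) b p x = Some y \<Longrightarrow> run f p x = Some y"
  by (rule approx_sound[of "prefix s" f b p x y]) (auto simp: prefix_def matches_def split: if_splits)

lemma approx_prefix_complete:
  assumes "run f p x = Some y"
  shows "\<exists>s. k \<le> pfst s \<and> matches s f \<and> approx (prefix s) (pfst s) p x = Some y"
proof -
  obtain c where c: "\<forall>k. pfst (c k) = k \<and> matches (c k) f"
    using ex_matches_sequence by blast
  have "eventually (\<lambda>k. approx (prefix (c k)) k p x = Some y) sequentially"
  proof (rule approx_complete[OF _ assms])
    show "eventually (\<lambda>k. prefix (c k) q = Some (f q)) sequentially" for q
      using eventually_gt_at_top[of q] by eventually_elim (use c in \<open>simp add: prefix_def matches_def\<close>)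
  qed
  then have "eventually (\<lambda>n. k \<le> n \<and> approx (prefix (c n)) n p x = Some y) sequentially"
    using eventually_ge_at_top[of k] by eventually_elim simp
  from eventually_happens'[OF sequentially_bot this]
  obtain n where "k \<le> n \<and> approx (prefix (c n)) n p x = Some y" by blast
  then show ?thesis using c by (intro exI[of _ "c n"]) simp
qed

text \<open>If every extension of the condition had a further extension computing \<open>g\<close>
  through \<open>p\<close>, then \<open>g\<close> would be computable: search for a string extending
  the condition on which \<open>p\<close> answers at \<open>x\<close>. Any such string extends to an
  oracle computing \<open>g\<close>, so its answer is \<open>g x\<close>.\<close>

lemma avoid_cone:
  assumes "\<not> computable g"
  shows "\<exists>k'\<ge>k. \<exists>h'. (\<forall>i<k. h' i = h i) \<and> (\<forall>f. (\<forall>i<k'. f i = h' i) \<longrightarrow> run f p \<noteq> Some \<circ> g)"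
proof (rule ccontr)
  assume "\<not> ?thesis"
  then have ext: "\<exists>f. (\<forall>i<k'. f i = h' i) \<and> run f p = Some \<circ> g"
    if "k \<le> k'" "\<forall>i<k. h' i = h i" for k' h'
    using that by blast
  \<comment> \<open>The number \<open>a\<close> hard-wires the finite condition into the search
    program, as \<open>h\<close> need not be computable.\<close>
  obtain a where a: "\<forall>i<k. entry a i = h i" using ex_entry by blast
  define A where "A s x = opt_code (approx (prefix s) (pfst s) p x)" for s x
  define P where "P x s \<longleftrightarrow> (\<forall>q<k. entry (psnd s) q = entry a q) \<and> \<not> pfst s < k \<and> \<not> A s x = 0" for x s
  have A: "total_rec (\<lambda>f x. A (F f x) (G f x))" if "total_rec F" "total_rec G" for F G
    unfolding A_def
    by (rule total_rec_comp2[OF total_rec_approx[of "\<lambda>f. prefix" "\<lambda>f. pfst"] that]) (intro rec_intros)+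
  have "partial_rec (\<lambda>f x. map_option (\<lambda>s. A s x - 1) (if \<exists>s. P x s then Some (LEAST s. P x s) else None))"
    unfolding P_def by (intro partial_rec_map partial_rec_Least rec_intros A)
  then obtain r where r: "\<forall>f x. run f r x = map_option (\<lambda>s. A s x - 1) (if \<exists>s. P x s then Some (LEAST s. P x s) else None)"
    by (rule partial_recE)
  have val: "A s x = Suc (g x)" if s: "P x s" for x s
  proof -
    obtain y where y: "approx (prefix s) (pfst s) p x = Some y" using s by (auto simp: P_def A_def)
    obtain f where f: "\<forall>i<pfst s. f i = entry (psnd s) i" "run f p = Some \<circ> g"
      using ext[of "pfst s" "entry (psnd s)"] s a by (auto simp: P_def)
    have "run f p x = Some y" using f(1) y by (intro approx_prefix_sound[of s]) (auto simp: matches_def)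
    with f(2) y show ?thesis by (simp add: A_def)
  qed
  have ex: "\<exists>s. P x s" for x
  proof -
    obtain f where f: "\<forall>i<k. f i = h i" "run f p = Some \<circ> g" using ext[of k h] by auto
    then have "run f p x = Some (g x)" by simp
    from approx_prefix_complete[OF this, of k] obtain s where
      "k \<le> pfst s" "matches s f" "approx (prefix s) (pfst s) p x = Some (g x)" by blast
    with f(1) a show ?thesis by (intro exI[of _ s]) (auto simp: P_def A_def matches_def)
  qed
  have "run (\<lambda>_. 0) r x = Some (g x)" for x
    using val[OF LeastI_ex[OF ex]] ex[of x] by (simp add: r)
  then have "computable g" unfolding computable_iff turing_le_def by (intro exI[of _ r]) auto
  with assms show False by blast
qed

lemma ex_avoiding:
  assumes "countable G" "\<forall>g\<in>G. \<not> computable g" "countable H"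
  shows "\<exists>f. f \<notin> H \<and> (\<forall>g\<in>G. \<not> turing_le g f)"
proof -
  \<comment> \<open>The trivial requirement keeps the family nonempty, as an enumeration by
    \<open>from_nat_into\<close> demands.\<close>
  define \<R> where "\<R> = (\<lambda>h f. f \<noteq> h) ` H \<union> (\<lambda>(p, g) f. run f p \<noteq> Some \<circ> g) ` (UNIV \<times> G) \<union> {\<lambda>_. True}"
  have count: "countable \<R>" unfolding \<R>_def using assms(1,3) countable_prog by simp
  have ne: "\<R> \<noteq> {}" by (simp add: \<R>_def)
  have dense: "\<exists>k'\<ge>k. \<exists>h'. (\<forall>i<k. h' i = h i) \<and> (\<forall>f. (\<forall>i<k'. f i = h' i) \<longrightarrow> R f)" if R: "R \<in> \<R>" for R k h
  proof -
    consider (ne) g where "R = (\<lambda>f. f \<noteq> g)" | (avoid) p g where "g \<in> G" "R = (\<lambda>f. run f p \<noteq> Some \<circ> g)"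
      | (triv) "R = (\<lambda>_. True)"
      using R unfolding \<R>_def by auto
    then show ?thesis
    proof cases
      case ne
      then show ?thesis
        by (intro exI[of _ "Suc k"] conjI exI[of _ "h(k := Suc (g k))"]) (auto simp: fun_upd_def)
    next
      case avoid
      then show ?thesis using avoid_cone[of g k h p] assms(2) by simp
    qed auto
  qed
  have "\<exists>f. \<forall>n. from_nat_into \<R> n f" by (rule dense_sequence, rule dense, rule from_nat_into[OF ne])
  then obtain f where f: "\<forall>n. from_nat_into \<R> n f" by blast
  have f: "R f" if "R \<in> \<R>" for R using from_nat_into_surj[OF count that] f by blast
  have "f \<noteq> h" if "h \<in> H" for h
    by (rule f) (unfold \<R>_def, intro UnI1 imageI that)
  moreover have "run f p \<noteq> Some \<circ> g" if "g \<in> G" for g p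
    by (rule f) (unfold \<R>_def, rule UnI1, rule UnI2, rule image_eqI[of _ _ "(p, g)"], simp_all only: prod.case mem_Times_iff fst_conv snd_conv UNIV_I that simp_thms)
  ultimately show ?thesis unfolding turing_le_def by blast
qed

text \<open>Degrees are added one at a time. The old \<open>F s\<close> join the functions that the
  new \<open>f\<close> must not compute, and their lower cones join the countable set that
  \<open>f\<close> must miss. Missing the computable functions too lets \<open>f\<close> play the
  role of an old \<open>F s\<close> in the next step.\<close>

lemma ex_antichain:
  assumes "finite T" "countable G" "\<forall>g\<in>G. \<not> computable g"
  shows "\<exists>F :: 'a \<Rightarrow> nat \<Rightarrow> nat. (\<forall>s\<in>T. \<not> computable (F s) \<and> (\<forall>g\<in>G. \<not> turing_le g (F s))) \<and>
    (\<forall>s\<in>T. \<forall>t\<in>T. s \<noteq> t \<longrightarrow> \<not> turing_le (F s) (F t))"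
  using assms(1)
proof induction
  case (insert t T)
  then obtain F :: "'a \<Rightarrow> nat \<Rightarrow> nat" where F: "\<forall>s\<in>T. \<not> computable (F s) \<and> (\<forall>g\<in>G. \<not> turing_le g (F s))"
    "\<forall>s\<in>T. \<forall>t\<in>T. s \<noteq> t \<longrightarrow> \<not> turing_le (F s) (F t)" by blast
  let ?H = "{h. computable h} \<union> (\<Union>s\<in>T. {h. turing_le h (F s)})"
  have "countable ?H" unfolding computable_iff using insert.hyps(1)
    by (intro countable_Un countable_UN countable_turing_cone) (simp add: countable_finite)
  moreover have "countable (G \<union> F ` T)" using assms(2) insert.hyps(1) by (simp add: countable_finite)
  moreover have "\<forall>g\<in>G \<union> F ` T. \<not> computable g" using assms(3) F(1) by blast
  ultimately obtain f where "f \<notin> ?H" "\<forall>g\<in>G \<union> F ` T. \<not> turing_le g f"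
    using ex_avoiding[of "G \<union> F ` T" ?H] by blast
  with F insert.hyps(2) show ?case by (intro exI[of _ "F(t := f)"]) auto
qed simp

section \<open>Joins, meets and residuals of mass problems\<close>

lemma medv_le_iff: "medv_le X Y \<longleftrightarrow> (\<exists>p. \<forall>f\<in>Y. \<exists>g\<in>X. run f p = Some \<circ> g)"
proof -
  have "(\<exists>n. Q (prog_decode n)) \<longleftrightarrow> (\<exists>p. Q p)" for Q :: "prog \<Rightarrow> bool"
    by (metis prog_decode_encode)
  from this[of "\<lambda>p. \<forall>f\<in>Y. \<exists>g\<in>X. run f p = Some \<circ> g"]
  show ?thesis by (simp only: medv_le_def total_in_def Phi_def)
qed

lemma medv_leI: "total_rec F \<Longrightarrow> (\<And>f. f \<in> Y \<Longrightarrow> F f \<in> X) \<Longrightarrow> medv_le X Y"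
  unfolding medv_le_iff total_rec_def by blast

lemma medv_le_subset: "Y \<subseteq> X \<Longrightarrow> medv_le X Y"
  by (rule medv_leI[of "\<lambda>f x. f x"]) (auto intro: rec_intros)

lemma medv_le_empty: "medv_le X {}"
  by (simp add: medv_le_subset)

lemma fun_join_simps [simp]: "fun_join a b (2 * n) = a n" "fun_join a b (Suc (2 * n)) = b n"
  by (simp_all add: fun_join_def)

lemma fun_cons_simps [simp]: "fun_cons i f 0 = i" "fun_cons i f (Suc n) = f n"
  by (simp_all add: fun_cons_def)

lemma total_rec_double [rec_intros]: "total_rec F \<Longrightarrow> total_rec (\<lambda>f x. 2 * F f x)"
  unfolding mult_2 by (intro rec_intros)

lemma mass_join_upper1: "medv_le X (mass_join X Y)"
proof (rule medv_leI)
  show "total_rec (\<lambda>f n. f (2 * n))" by (intro rec_intros)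
qed (auto simp: mass_join_def)

lemma mass_join_upper2: "medv_le Y (mass_join X Y)"
proof (rule medv_leI)
  show "total_rec (\<lambda>f n. f (Suc (2 * n)))" by (intro rec_intros)
qed (auto simp: mass_join_def)

lemma mass_join_least: "medv_le X Z \<Longrightarrow> medv_le Y Z \<Longrightarrow> medv_le (mass_join X Y) Z"
proof -
  assume "medv_le X Z" "medv_le Y Z"
  then obtain p q where p: "\<forall>f\<in>Z. \<exists>g\<in>X. run f p = Some \<circ> g" and q: "\<forall>f\<in>Z. \<exists>g\<in>Y. run f q = Some \<circ> g"
    unfolding medv_le_iff by (elim exE)
  obtain r where r: "\<forall>f a b. run f p = Some \<circ> a \<longrightarrow> run f q = Some \<circ> b \<longrightarrow> run f r = Some \<circ> fun_join a b"
    using run_join_ex by blast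
  have "\<exists>g\<in>mass_join X Y. run f r = Some \<circ> g" if f: "f \<in> Z" for f
  proof -
    obtain a b where "a \<in> X" "run f p = Some \<circ> a" "b \<in> Y" "run f q = Some \<circ> b" using p q f by blast
    then show ?thesis
      by (intro bexI[of _ "fun_join a b"] r[rule_format]) (auto simp only: mass_join_def)
  qed
  then show ?thesis unfolding medv_le_iff by blast
qed

lemma mass_join_le_iff: "medv_le (mass_join X Y) Z \<longleftrightarrow> medv_le X Z \<and> medv_le Y Z"
  using mass_join_least[of X Z Y] medv_le_trans[OF mass_join_upper1, of X Y Z]
    medv_le_trans[OF mass_join_upper2, of X Y Z] by argo

lemma run_if_ex:
  assumes "decidable P"
  shows "\<exists>r. \<forall>f x. run f r x = (if P f x then run f p x else run f q x)"
proof -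
  obtain c where c: "\<forall>f x. run f c x = Some (if P f x then 1 else 0)"
    using assms unfolding decidable_def by (rule total_recE)
  have "total_rec (\<lambda>f x. if P f x then 0 else 1)" using assms by (intro rec_intros)
  then obtain d where d: "\<forall>f x. run f d x = Some (if P f x then 0 else 1)" by (rule total_recE)
  have "total_rec (\<lambda>f w. pfst w + psnd w)" by (intro rec_intros)
  then obtain s where s: "\<forall>f w. run f s w = Some (pfst w + psnd w)" by (rule total_recE)
  \<comment> \<open>\<^const>\<open>PPrec\<close> runs its second argument only as often as its counter says; a strict selection
    would diverge with the branch that is not taken.\<close>
  define g where "g e p = PComp (PPrec PZero (PComp p PFst)) (PPair (PPair PFst PSnd) e)" for e p
  have g1: "run f (g e p) x = run f p x" if "run f e x = Some 1" for f e p x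
    using that by (simp add: g_def)
  have g0: "run f (g e p) x = Some 0" if "run f e x = Some 0" for f e p x
    using that by (simp add: g_def)
  have "run f (PComp s (PPair (g c p) (g d q))) x = (if P f x then run f p x else run f q x)" for f x
    by (cases "P f x"; cases "run f p x"; cases "run f q x") (simp_all add: s c d g0 g1)
  then show ?thesis by blast
qed

lemma mass_meet_lower1: "medv_le (mass_meet X Y) X"
proof (rule medv_leI)
  show "total_rec (\<lambda>f. fun_cons 0 f)" by (intro rec_intros)
qed (auto simp: mass_meet_def)

lemma mass_meet_lower2: "medv_le (mass_meet X Y) Y"
proof (rule medv_leI)
  show "total_rec (\<lambda>f. fun_cons 1 f)" by (intro rec_intros)
qed (auto simp: mass_meet_def)

lemma mass_meet_greatest: "medv_le Z X \<Longrightarrow> medv_le Z Y \<Longrightarrow> medv_le Z (mass_meet X Y)"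
proof -
  assume "medv_le Z X" "medv_le Z Y"
  then obtain p q where p: "\<forall>f\<in>X. \<exists>g\<in>Z. run f p = Some \<circ> g" and q: "\<forall>f\<in>Y. \<exists>g\<in>Z. run f q = Some \<circ> g"
    unfolding medv_le_iff by blast
  have "total_rec (\<lambda>f x. f (Suc x))" by (intro rec_intros)
  then obtain t where t: "\<And>f. run f t = Some \<circ> (\<lambda>x. f (Suc x))" unfolding total_rec_def by blast
  have tl: "run f (oracle_subst t p) = run (\<lambda>x. f (Suc x)) p" for f p by (intro run_oracle_subst t)
  \<comment> \<open>The branch not chosen may diverge, since \<open>p\<close> is only known to work
    on \<open>X\<close> and \<open>q\<close> on \<open>Y\<close>; hence the non-strict choice of
    \<open>run_if_ex\<close>.\<close>
  have "decidable (\<lambda>f x. f 0 = 0)" by (intro rec_intros)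
  then obtain r where r: "\<And>f x. run f r x = (if f 0 = 0 then run f (oracle_subst t p) x else run f (oracle_subst t q) x)"
    using run_if_ex by blast
  have "run (fun_cons 0 f) r = run f p" "run (fun_cons 1 f) r = run f q" for f
    by (auto simp: r tl)
  then have "\<exists>g\<in>Z. run f r = Some \<circ> g" if "f \<in> mass_meet X Y" for f
    using p q that unfolding mass_meet_def by auto
  then show ?thesis unfolding medv_le_iff by blast
qed

lemma le_mass_meet_iff: "medv_le Z (mass_meet X Y) \<longleftrightarrow> medv_le Z X \<and> medv_le Z Y"
  using mass_meet_greatest[of Z X Y] medv_le_trans[OF _ mass_meet_lower1, of Z X Y]
    medv_le_trans[OF _ mass_meet_lower2, of Z X Y] by argo

section \<open>Reductions from a join whose left argument is known only up to a finite
  string\<close>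

definition join_prefix :: "nat \<Rightarrow> (nat \<Rightarrow> nat) \<Rightarrow> nat \<Rightarrow> nat option" where
  "join_prefix s c q = (if even q then prefix s (q div 2) else Some (c (q div 2)))"

lemma total_rec_approx_join_prefix:
  assumes "total_rec (\<lambda>f w. C f (psnd w))" "total_rec F" "total_rec G"
  shows "total_rec (\<lambda>f x. opt_code (approx (join_prefix (F f x) (C f)) (pfst (F f x)) p (G f x)))"
proof -
  have C: "total_rec (\<lambda>f x. C f (N f x))" if "total_rec N" for N
    using total_rec_comp[OF assms(1), of "\<lambda>f x. prod_encode (0, N f x)"] that by (simp add: rec_intros)
  have "opt_code (join_prefix s c q) = (if even q then opt_code (prefix s (q div 2)) else Suc (c (q div 2)))" for s c q
    by (simp add: join_prefix_def)
  moreover have "total_rec (\<lambda>f w. if even (psnd w) then opt_code (prefix (pfst w) (psnd w div 2)) else Suc (C f (psnd w div 2)))"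
    by (intro rec_intros C)
  ultimately have "total_rec (\<lambda>f w. opt_code (join_prefix (pfst w) (C f) (psnd w)))" by simp
  from total_rec_approx[of "\<lambda>f s. join_prefix s (C f)", OF this, of "\<lambda>f. pfst"]
  have "total_rec (\<lambda>f w. opt_code (approx (join_prefix (pfst w) (C f)) (pfst (pfst w)) p (psnd w)))"
    by (simp add: rec_intros)
  from total_rec_comp2[OF this assms(2,3)] show ?thesis .
qed

lemma approx_join_prefix_sound:
  "matches s f \<Longrightarrow> approx (join_prefix s c) b p x = Some y \<Longrightarrow> run (fun_join f c) p x = Some y"
  by (rule approx_sound[of "join_prefix s c" "fun_join f c" b p x y])
    (auto simp: prefix_def matches_def join_prefix_def fun_join_def split: if_splits)

lemma approx_join_prefix_complete:
  assumes "run (fun_join f c) p x = Some y"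
  shows "\<exists>s. matches s f \<and> approx (join_prefix s c) (pfst s) p x = Some y"
proof -
  obtain d where d: "\<forall>k. pfst (d k) = k \<and> matches (d k) f"
    using ex_matches_sequence by blast
  have "eventually (\<lambda>k. approx (join_prefix (d k) c) k p x = Some y) sequentially"
  proof (rule approx_complete[OF _ assms])
    show "eventually (\<lambda>k. join_prefix (d k) c q = Some (fun_join f c q)) sequentially" for q
      using eventually_gt_at_top[of "q div 2"]
      by eventually_elim (use d in \<open>auto simp: prefix_def matches_def join_prefix_def fun_join_def\<close>)
  qed
  from eventually_happens'[OF sequentially_bot this]
  obtain n where "approx (join_prefix (d n) c) n p x = Some y" by blast
  then show ?thesis using d by (intro exI[of _ "d n"]) simp
qed

text \<open>
  A finite initial segment of a possible element of \<open>X\<close> already decides, for a given \<open>c \<in> C\<close>, which of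
  \<open>Y\<close> and \<open>Z\<close> the functional answers with; the closure of \<open>X\<close> under \<^const>\<open>overwrite\<close> lets every element
  of \<open>X\<close> start with that segment.
\<close>

lemma mass_meet_splits:
  assumes "X \<noteq> {}" and ow: "\<And>x s. x \<in> X \<Longrightarrow> overwrite s x \<in> X"
    and le: "medv_le (mass_meet Y Z) (mass_join X C)"
  shows "\<exists>C0 C1. medv_le (mass_meet C0 C1) C \<and> medv_le Y (mass_join X C0) \<and> medv_le Z (mass_join X C1)"
proof -
  obtain p where p: "\<forall>f\<in>mass_join X C. \<exists>g\<in>mass_meet Y Z. run f p = Some \<circ> g"
    using le unfolding medv_le_iff by blast
  \<comment> \<open>Elements keep \<open>s\<close> in front of \<open>c\<close>, so that a reduction
    can later impose this string on any \<open>x\<close>; \<open>i\<close> is the tag that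
    \<open>p\<close> then answers with.\<close>
  define D where "D i V = {fun_cons s c | s c. \<forall>x\<in>X. \<exists>y\<in>V. run (fun_join (overwrite s x) c) p = Some \<circ> fun_cons i y}"
    for i V
  define A where "A c s = opt_code (approx (join_prefix s c) (pfst s) p 0)" for c s
  have A: "total_rec (\<lambda>f x. A f (F f x))" if "total_rec F" for F
    unfolding A_def by (intro total_rec_approx_join_prefix that rec_intros)
  \<comment> \<open>Using \<open>c\<close> alone: find the least string on which \<open>p\<close>
    answers at 0, and put that answer and the string in front of \<open>c\<close>.\<close>
  have "partial_rec (\<lambda>c n. map_option (\<lambda>s. fun_cons (A c s - 1) (fun_cons s c) n)
    (if \<exists>s. \<not> A c s = 0 then Some (LEAST s. \<not> A c s = 0) else None))"
    by (intro partial_rec_map partial_rec_Least rec_intros A)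
  then obtain r where r: "\<forall>c n. run c r n = map_option (\<lambda>s. fun_cons (A c s - 1) (fun_cons s c) n)
    (if \<exists>s. \<not> A c s = 0 then Some (LEAST s. \<not> A c s = 0) else None)"
    by (rule partial_recE)
  have "\<exists>g\<in>mass_meet (D 0 Y) (D 1 Z). run c r = Some \<circ> g" if c: "c \<in> C" for c
  proof -
    have x: "\<exists>g\<in>mass_meet Y Z. run (fun_join x c) p = Some \<circ> g" if "x \<in> X" for x
      using p that c by (auto simp: mass_join_def)
    obtain x0 where "x0 \<in> X" using assms(1) by blast
    then obtain g0 where "run (fun_join x0 c) p 0 = Some (g0 0)" using x by fastforce
    then have ex: "\<exists>s. \<not> A c s = 0" using approx_join_prefix_complete by (fastforce simp: A_def)
    define s where "s = (LEAST s. \<not> A c s = 0)"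
    have "\<not> A c s = 0" using LeastI_ex[OF ex] by (simp add: s_def)
    then obtain v where v: "approx (join_prefix s c) (pfst s) p 0 = Some v" by (auto simp: A_def)
    have run: "run c r = Some \<circ> fun_cons v (fun_cons s c)"
    proof
      have "A c s = Suc v" using v by (simp add: A_def)
      then show "run c r n = (Some \<circ> fun_cons v (fun_cons s c)) n" for n
        using ex by (simp add: r s_def[symmetric] del: neq0_conv)
    qed
    have g: "\<exists>g\<in>mass_meet Y Z. run (fun_join (overwrite s x) c) p = Some \<circ> g \<and> g 0 = v" if X: "x \<in> X" for x
    proof -
      obtain g where "g \<in> mass_meet Y Z" "run (fun_join (overwrite s x) c) p = Some \<circ> g"
        using x[OF ow[OF X]] by blast
      moreover have "run (fun_join (overwrite s x) c) p 0 = Some v"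
        by (rule approx_join_prefix_sound[OF matches_overwrite v])
      ultimately show ?thesis by auto
    qed
    then have "v = 0 \<or> v = 1" using \<open>x0 \<in> X\<close> by (fastforce simp: mass_meet_def)
    then show ?thesis
    proof
      assume "v = 0"
      then have "fun_cons s c \<in> D 0 Y" unfolding D_def using g by (fastforce simp: mass_meet_def)
      then show ?thesis unfolding run \<open>v = 0\<close> mass_meet_def by blast
    next
      assume "v = 1"
      then have "fun_cons s c \<in> D 1 Z" unfolding D_def using g by (fastforce simp: mass_meet_def)
      then show ?thesis unfolding run \<open>v = 1\<close> mass_meet_def by blast
    qed
  qed
  then have "medv_le (mass_meet (D 0 Y) (D 1 Z)) C" unfolding medv_le_iff by blast
  moreover have "medv_le V (mass_join X (D i V))" for i V
  proof -
    \<comment> \<open>In \<open>fun_join x (fun_cons s c)\<close> position 1 holds \<open>s\<close>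
      and \<open>c\<close> starts at position 3, so at odd \<open>q\<close> a shift by two reads
      \<open>c\<close>.\<close>
    define J where "J f q = (if even q then if q div 2 < pfst (f (Suc 0)) then entry (psnd (f (Suc 0))) (q div 2) else f q
      else f (Suc (Suc q)))" for f q
    have "total_rec J" unfolding J_def by (intro rec_intros)
    then obtain j where j: "\<And>f. run f j = Some \<circ> J f" unfolding total_rec_def by blast
    have J: "J (fun_join x (fun_cons s c)) = fun_join (overwrite s x) c" for x s c
      by (auto simp: J_def fun_join_def overwrite_def fun_eq_iff elim: oddE)
    \<comment> \<open>Precomposing with \<open>PSucc\<close> drops the tag \<open>i\<close> from the
      output of \<open>p\<close>.\<close>
    have "run f (PComp (oracle_subst j p) PSucc) = (\<lambda>n. run (J f) p (Suc n))" for f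
      by (simp add: run_oracle_subst[OF j])
    then have "\<forall>f\<in>mass_join X (D i V). \<exists>g\<in>V. run f (PComp (oracle_subst j p) PSucc) = Some \<circ> g"
      unfolding mass_join_def D_def by (fastforce simp: J)
    then show ?thesis unfolding medv_le_iff by blast
  qed
  ultimately show ?thesis by blast
qed

text \<open>
  The elements of \<open>E\<close> are tables of a functional on finite approximations of its argument; unlike
  \<^const>\<open>mass_imp\<close>, they are evaluated without a universal program.
\<close>

lemma ex_mass_residual: "\<exists>E. \<forall>C. medv_le B (mass_join Q C) \<longleftrightarrow> medv_le E C"
proof -
  \<comment> \<open>The table \<open>h\<close> holds at \<open>(n, s)\<close> either 0 for no
    answer, or \<open>Suc y\<close> for the answer \<open>y\<close> at input \<open>n\<close> after
    seeing the string \<open>s\<close> of the argument.\<close>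
  define P where "P h q n s \<longleftrightarrow> matches s q \<and> \<not> h (prod_encode (n, s)) = 0" for h q :: "nat \<Rightarrow> nat" and n s
  define ev where "ev h q n = map_option (\<lambda>s. h (prod_encode (n, s)) - 1)
    (if \<exists>s. P h q n s then Some (LEAST s. P h q n s) else None)" for h q n
  define E where "E = {h. \<forall>q\<in>Q. \<exists>b\<in>B. ev h q = Some \<circ> b}"
  have "partial_rec (\<lambda>f. ev (\<lambda>n. f (Suc (2 * n))) (\<lambda>n. f (2 * n)))"
    unfolding ev_def P_def by (intro partial_rec_map partial_rec_Least rec_intros)
  then obtain r where r: "\<And>f. run f r = ev (\<lambda>n. f (Suc (2 * n))) (\<lambda>n. f (2 * n))"
    unfolding partial_rec_def by blast
  have E: "medv_le B (mass_join Q E)"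
    unfolding medv_le_iff by (rule exI[of _ r]) (auto simp: mass_join_def r E_def)
  have "medv_le E C" if le: "medv_le B (mass_join Q C)" for C
  proof -
    obtain p where p: "\<forall>f\<in>mass_join Q C. \<exists>g\<in>B. run f p = Some \<circ> g" using le unfolding medv_le_iff by blast
    define H where "H c w = opt_code (approx (join_prefix (psnd w) c) (pfst (psnd w)) p (pfst w))" for c w
    have "H c \<in> E" if c: "c \<in> C" for c
    proof -
      have "\<exists>b\<in>B. ev (H c) q = Some \<circ> b" if q: "q \<in> Q" for q
      proof -
        obtain b where b: "b \<in> B" "run (fun_join q c) p = Some \<circ> b" using p c q by (auto simp: mass_join_def)
        have ex: "\<exists>s. P (H c) q n s" for n
          using approx_join_prefix_complete[of q c p n "b n"] b(2) by (force simp: P_def H_def)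
        \<comment> \<open>By soundness all matching strings with an answer agree, so taking the
          least one is harmless.\<close>
        have "H c (prod_encode (n, s)) = Suc (b n)" if s: "P (H c) q n s" for n s
        proof -
          obtain y where y: "approx (join_prefix s c) (pfst s) p n = Some y" "matches s q"
            using s by (auto simp: P_def H_def)
          with approx_join_prefix_sound[OF y(2,1)] b(2) show ?thesis by (simp add: H_def)
        qed
        from this[OF LeastI_ex[OF ex]] have "ev (H c) q = Some \<circ> b"
          using ex by (auto simp: ev_def)
        with b(1) show ?thesis by blast
      qed
      then show ?thesis by (simp add: E_def)
    qed
    moreover have "total_rec H" unfolding H_def by (intro total_rec_approx_join_prefix rec_intros)
    ultimately show ?thesis using medv_leI by blast
  qed
  moreover have "medv_le B (mass_join Q C)" if "medv_le E C" for C
  proof -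
    have "medv_le (mass_join Q E) (mass_join Q C)"
      using that by (meson mass_join_le_iff mass_join_upper1 mass_join_upper2 medv_le_trans)
    with E show ?thesis by (rule medv_le_trans)
  qed
  ultimately show ?thesis by blast
qed

lemma le_mass_join_commute: "medv_le W (mass_join X Y) \<longleftrightarrow> medv_le W (mass_join Y X)"
  using mass_join_least[OF mass_join_upper2 mass_join_upper1] medv_le_trans by blast

lemma mass_join_mono: "medv_le X X' \<Longrightarrow> medv_le Y Y' \<Longrightarrow> medv_le (mass_join X Y) (mass_join X' Y')"
  using mass_join_least medv_le_trans mass_join_upper1 mass_join_upper2 by meson

lemma le_mass_join_left: "medv_le W X \<Longrightarrow> medv_le W (mass_join X Y)"
  using medv_le_trans mass_join_upper1 by blast

lemma le_mass_join_right: "medv_le W Y \<Longrightarrow> medv_le W (mass_join X Y)"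
  using medv_le_trans mass_join_upper2 by blast

lemma mass_meet_le_left: "medv_le X W \<Longrightarrow> medv_le (mass_meet X Y) W"
  using medv_le_trans mass_meet_lower1 by blast

lemma mass_meet_le_right: "medv_le Y W \<Longrightarrow> medv_le (mass_meet X Y) W"
  using medv_le_trans mass_meet_lower2 by blast

text \<open>Distributivity follows from the residual: each condition takes the form
  \<open>medv_le R C\<close>, and these split over meets.\<close>

lemma le_mass_join_meet_iff:
  "medv_le W (mass_join X (mass_meet Y Z)) \<longleftrightarrow> medv_le W (mass_join X Y) \<and> medv_le W (mass_join X Z)"
proof -
  obtain R where "\<forall>C. medv_le W (mass_join X C) \<longleftrightarrow> medv_le R C" using ex_mass_residual by blast
  then show ?thesis by (simp add: le_mass_meet_iff)
qed

text \<open>A single oracle yields a single output, whose tag picks one side once and for all; for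
  larger mass problems the tag may vary with the oracle.\<close>

lemma mass_meet_le_singleton:
  assumes "medv_le (mass_meet X Y) {h}"
  shows "medv_le X {h} \<or> medv_le Y {h}"
proof -
  obtain p g where "g \<in> mass_meet X Y" "run h p = Some \<circ> g" using assms unfolding medv_le_iff by blast
  then obtain i f where f: "run h p = Some \<circ> fun_cons i f" "f \<in> X \<or> f \<in> Y" unfolding mass_meet_def by blast
  then have "run h (PComp p PSucc) = Some \<circ> f" by auto
  with f(2) show ?thesis unfolding medv_le_iff by blast
qed

section \<open>Finite meets\<close>

primrec meet_list :: "mass list \<Rightarrow> mass \<Rightarrow> mass" where
  "meet_list [] E = E"
| "meet_list (X # Xs) E = mass_meet X (meet_list Xs E)"

lemma le_meet_list_iff: "medv_le Z (meet_list Xs E) \<longleftrightarrow> (\<forall>X\<in>set Xs. medv_le Z X) \<and> medv_le Z E"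
  by (induction Xs) (auto simp: le_mass_meet_iff)

lemma meet_list_le_singleton:
  "medv_le (meet_list Xs E) {h} \<Longrightarrow> (\<exists>X\<in>set Xs. medv_le X {h}) \<or> medv_le E {h}"
  by (induction Xs) (auto dest!: mass_meet_le_singleton)

section \<open>Embedding upsets of a power set\<close>

definition upset :: "'a set \<Rightarrow> 'a set set \<Rightarrow> bool" where
  "upset T \<V> \<longleftrightarrow> \<V> \<subseteq> Pow T \<and> (\<forall>S\<in>\<V>. \<forall>R. S \<subseteq> R \<longrightarrow> R \<subseteq> T \<longrightarrow> R \<in> \<V>)"

definition upset_imp :: "'a set \<Rightarrow> 'a set set \<Rightarrow> 'a set set \<Rightarrow> 'a set set" where
  "upset_imp T \<U> \<V> = {S\<in>Pow T. \<forall>R. S \<subseteq> R \<longrightarrow> R \<subseteq> T \<longrightarrow> R \<in> \<U> \<longrightarrow> R \<in> \<V>}"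

text \<open>Truth sets of Kripke semantics on the frame \<open>Pow T\<close> ordered by inclusion;
  upsets are the persistent valuations.\<close>

primrec upset_val :: "'a set \<Rightarrow> (nat \<Rightarrow> 'a set set) \<Rightarrow> form \<Rightarrow> 'a set set" where
  "upset_val T V (Var i) = V i"
| "upset_val T V Falsum = {}"
| "upset_val T V (And A B) = upset_val T V A \<inter> upset_val T V B"
| "upset_val T V (Or A B) = upset_val T V A \<union> upset_val T V B"
| "upset_val T V (Imp A B) = upset_imp T (upset_val T V A) (upset_val T V B)"

lemma upsetD: "upset T \<V> \<Longrightarrow> S \<in> \<V> \<Longrightarrow> S \<subseteq> R \<Longrightarrow> R \<subseteq> T \<Longrightarrow> R \<in> \<V>"
  unfolding upset_def by (elim conjE) (drule bspec, assumption, simp)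

lemma upset_Int: "upset T \<U> \<Longrightarrow> upset T \<V> \<Longrightarrow> upset T (\<U> \<inter> \<V>)"
  unfolding upset_def by auto

lemma upset_Un: "upset T \<U> \<Longrightarrow> upset T \<V> \<Longrightarrow> upset T (\<U> \<union> \<V>)"
  unfolding upset_def by auto

lemma upset_upset_imp: "upset T (upset_imp T \<U> \<V>)"
  unfolding upset_def
proof (intro conjI ballI allI impI)
  fix S R assume "S \<in> upset_imp T \<U> \<V>" "S \<subseteq> R" "R \<subseteq> T"
  then show "R \<in> upset_imp T \<U> \<V>" unfolding upset_imp_def using order_trans[of S R] by auto
qed (auto simp: upset_imp_def)

lemma upset_upset_val: "(\<And>i. upset T (V i)) \<Longrightarrow> upset T (upset_val T V A)"
proof (induction A)
  case Falsum
  then show ?case by (simp add: upset_def)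
qed (simp_all add: upset_Int upset_Un upset_upset_imp)

lemma top_in_upset: "upset T \<V> \<Longrightarrow> \<V> \<noteq> {} \<Longrightarrow> T \<in> \<V>"
  unfolding upset_def by blast

text \<open>A point \<open>R\<close> of \<open>\<U>\<close> above \<open>P\<close> equals
  \<open>P \<union> R\<close>, so only unions of \<open>P\<close> with members of
  \<open>\<U>\<close> have to be tested. The implication becomes an intersection of residuals by
  single sets, which \<open>embed_residual\<close> treats one at a time.\<close>

lemma upset_imp_eq:
  assumes "upset T \<U>" "upset T \<V>"
  shows "upset_imp T \<U> \<V> = Pow T \<inter> (\<Inter>S\<in>\<U>. {P\<in>Pow T. P \<union> S \<in> \<V>})"
proof (intro equalityI subsetI)
  fix P assume P: "P \<in> upset_imp T \<U> \<V>"
  have "P \<union> S \<in> \<V>" if "S \<in> \<U>" for S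
  proof -
    have "S \<subseteq> T" using assms(1) that by (auto simp: upset_def)
    moreover have "P \<subseteq> T" using P by (simp add: upset_imp_def)
    moreover from calculation have "P \<union> S \<in> \<U>" using assms(1) that by (auto simp: upset_def)
    ultimately show ?thesis using P by (simp add: upset_imp_def)
  qed
  with P show "P \<in> Pow T \<inter> (\<Inter>S\<in>\<U>. {P\<in>Pow T. P \<union> S \<in> \<V>})" by (simp add: upset_imp_def)
next
  fix P assume "P \<in> Pow T \<inter> (\<Inter>S\<in>\<U>. {P\<in>Pow T. P \<union> S \<in> \<V>})"
  then show "P \<in> upset_imp T \<U> \<V>" by (auto simp: upset_imp_def Un_absorb1)
qed

section \<open>Mass problems that avoid lower cones\<close>

definition avoiding :: "('a \<Rightarrow> nat \<Rightarrow> nat) \<Rightarrow> 'a set \<Rightarrow> mass" where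
  "avoiding F S = {g. \<forall>s\<in>S. \<not> turing_le g (F s)}"

lemma avoiding_empty: "avoiding F {} = UNIV"
  by (simp add: avoiding_def)

lemma avoiding_antimono: "S \<subseteq> R \<Longrightarrow> avoiding F R \<subseteq> avoiding F S"
  by (auto simp: avoiding_def)

text \<open>The identity reduces: a join computes both its halves, so if it lay below some
  \<open>F s\<close>, both halves would too.\<close>

lemma avoiding_Un_le: "medv_le (avoiding F (S \<union> R)) (mass_join (avoiding F S) (avoiding F R))"
proof (rule medv_le_subset, rule subsetI)
  fix g assume "g \<in> mass_join (avoiding F S) (avoiding F R)"
  then obtain a b where g: "g = fun_join a b" "a \<in> avoiding F S" "b \<in> avoiding F R"
    unfolding mass_join_def by blast
  have "turing_le (\<lambda>n. g (2 * n)) g" by (rule turing_le_total_rec) (intro rec_intros)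
  moreover have "turing_le (\<lambda>n. g (Suc (2 * n))) g" by (rule turing_le_total_rec) (intro rec_intros)
  ultimately have "turing_le a g" "turing_le b g" unfolding g(1) fun_join_simps by blast+
  with g(2,3) show "g \<in> avoiding F (S \<union> R)" unfolding avoiding_def using turing_le_trans by blast
qed

text \<open>Overwriting once more with the old values restores \<open>x\<close>, so the change does
  not lower the Turing degree. This is the closure hypothesis of
  \<open>mass_meet_splits\<close>.\<close>

lemma overwrite_avoiding:
  assumes "x \<in> avoiding F S"
  shows "overwrite s x \<in> avoiding F S"
proof -
  obtain s' where "pfst s' = pfst s" "matches s' x" using ex_matches by blast
  then have "overwrite s' (overwrite s x) = x" by (auto simp: overwrite_def matches_def fun_eq_iff)
  then have "turing_le x (overwrite s x)" using turing_le_overwrite[of s' "overwrite s x"] by simp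
  with assms show ?thesis unfolding avoiding_def using turing_le_trans by blast
qed

text \<open>By \<open>B_le_iff\<close>, \<open>E\<close> is the residual of \<open>B\<close> by
  \<open>avoiding F T\<close>, which exists by \<open>ex_mass_residual\<close>. As
  \<open>{\<lambda>_. 0}\<close> has the least degree, \<open>B_nonzero\<close> says that
  \<open>B\<close> is not 0.\<close>

locale antichain_below =
  fixes T :: "'a set" and F :: "'a \<Rightarrow> nat \<Rightarrow> nat" and B E :: mass
  assumes finite_T: "finite T"
    and antichain: "\<And>s t. s \<in> T \<Longrightarrow> t \<in> T \<Longrightarrow> s \<noteq> t \<Longrightarrow> \<not> turing_le (F s) (F t)"
    and not_B_le: "\<not> medv_le B (avoiding F T)"
    and B_le_iff: "\<And>C. medv_le B (mass_join (avoiding F T) C) \<longleftrightarrow> medv_le E C"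
    and B_nonzero: "\<not> medv_le B {\<lambda>_. 0}"
begin

text \<open>
  \<open>E\<close> is the negation of \<^term>\<open>avoiding F T\<close> below \<open>B\<close>. Adding it to every nonempty meet makes the
  images of all nonempty upsets dense, that is, with negation \<open>B\<close>.
\<close>

definition embed :: "'a set set \<Rightarrow> mass" where
  "embed \<V> = (if \<V> = {} then B else meet_list (map (avoiding F) (SOME l. set l = \<V>)) E)"

lemma embed_eq_meet_list:
  assumes "\<V> \<subseteq> Pow T" "\<V> \<noteq> {}"
  obtains l where "set l = \<V>" "embed \<V> = meet_list (map (avoiding F) l) E"
proof -
  have "finite \<V>" using assms(1) finite_T by (meson finite_Pow_iff finite_subset)
  then have "\<exists>l. set l = \<V>" by (rule finite_list)
  then have "set (SOME l. set l = \<V>) = \<V>" by (rule someI_ex)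
  then show thesis by (rule that) (use assms(2) in \<open>simp add: embed_def\<close>)
qed

text \<open>Determines \<open>embed \<V>\<close> up to equivalence, so the list chosen by
  \<open>SOME\<close> does not matter.\<close>

lemma le_embed_iff:
  assumes "\<V> \<subseteq> Pow T" "\<V> \<noteq> {}"
  shows "medv_le Z (embed \<V>) \<longleftrightarrow> (\<forall>S\<in>\<V>. medv_le Z (avoiding F S)) \<and> medv_le Z E"
proof -
  obtain l where "set l = \<V>" "embed \<V> = meet_list (map (avoiding F) l) E"
    by (rule embed_eq_meet_list[OF assms])
  then show ?thesis by (simp add: le_meet_list_iff)
qed

lemma le_join_embed_iff:
  assumes "\<V> \<subseteq> Pow T" "\<V> \<noteq> {}"
  shows "medv_le W (mass_join X (embed \<V>)) \<longleftrightarrow>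
    (\<forall>S\<in>\<V>. medv_le W (mass_join X (avoiding F S))) \<and> medv_le W (mass_join X E)"
proof -
  obtain R where "\<forall>C. medv_le W (mass_join X C) \<longleftrightarrow> medv_le R C" using ex_mass_residual by blast
  then show ?thesis by (simp add: le_embed_iff[OF assms])
qed

lemma E_le_B: "medv_le E B"
  by (rule B_le_iff[THEN iffD1, OF mass_join_upper2])

lemma embed_le_avoiding: "\<V> \<subseteq> Pow T \<Longrightarrow> S \<in> \<V> \<Longrightarrow> medv_le (embed \<V>) (avoiding F S)"
  using le_embed_iff[THEN iffD1, OF _ _ medv_le_refl, of \<V>] by auto

lemma embed_le_E: "\<V> \<subseteq> Pow T \<Longrightarrow> \<V> \<noteq> {} \<Longrightarrow> medv_le (embed \<V>) E"
  using le_embed_iff[THEN iffD1, OF _ _ medv_le_refl, of \<V>] by simp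

lemma embed_empty: "embed {} = B"
  by (simp add: embed_def)

lemma embed_le_B: "\<V> \<subseteq> Pow T \<Longrightarrow> medv_le (embed \<V>) B"
  by (cases "\<V> = {}") (simp_all add: embed_empty medv_le_refl medv_le_trans[OF embed_le_E E_le_B])

lemma embed_antimono:
  assumes "\<U> \<subseteq> \<V>" "\<V> \<subseteq> Pow T"
  shows "medv_le (embed \<V>) (embed \<U>)"
proof (cases "\<U> = {}")
  case True
  then show ?thesis using embed_le_B[OF assms(2)] by (simp add: embed_empty)
next
  case False
  then have "\<U> \<subseteq> Pow T" "\<V> \<noteq> {}" using assms by auto
  then show ?thesis
    using le_embed_iff[OF _ False, of "embed \<V>"] embed_le_avoiding[OF assms(2)] embed_le_E[OF assms(2)] assms(1)
    by auto
qed

lemma embed_Pow_le: "medv_le (embed (Pow T)) C"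
proof -
  have "medv_le (embed (Pow T)) UNIV" using embed_le_avoiding[of "Pow T" "{}"] by (simp add: avoiding_empty)
  then show ?thesis by (rule medv_le_trans) (simp add: medv_le_subset)
qed

text \<open>For nonempty upsets, joins distribute over both finite meets. What remains are joins of
  \<open>avoiding F R\<close> and \<open>avoiding F S\<close>, which lie above
  \<open>avoiding F (R \<union> S)\<close> with \<open>R \<union> S\<close> in both upsets; the
  terms with \<open>E\<close> are trivial.\<close>

lemma embed_Int_le:
  assumes "upset T \<U>" "upset T \<V>"
  shows "medv_le (embed (\<U> \<inter> \<V>)) (mass_join (embed \<U>) (embed \<V>))"
proof (cases "\<U> = {} \<or> \<V> = {}")
  case True
  then show ?thesis using mass_join_upper1 mass_join_upper2 embed_empty by force
next
  case False
  have sub: "\<U> \<subseteq> Pow T" "\<V> \<subseteq> Pow T" using assms by (auto simp: upset_def)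
  \<comment> \<open>Nonempty upsets all contain \<open>T\<close>, so the intersection does not fall
    back to \<open>embed {} = B\<close>.\<close>
  have "T \<in> \<U> \<inter> \<V>" using False top_in_upset[OF assms(1)] top_in_upset[OF assms(2)] by simp
  then have ne: "\<U> \<inter> \<V> \<noteq> {}" by blast
  have subI: "\<U> \<inter> \<V> \<subseteq> Pow T" using sub by blast
  have E: "medv_le (embed (\<U> \<inter> \<V>)) E" by (rule embed_le_E[OF subI ne])
  have "medv_le (embed (\<U> \<inter> \<V>)) (mass_join (avoiding F R) (avoiding F S))" if "S \<in> \<U>" "R \<in> \<V>" for S R
  proof -
    have "R \<union> S \<subseteq> T" using that sub by blast
    then have "R \<union> S \<in> \<U> \<inter> \<V>"
      using upsetD[OF assms(1) that(1), of "R \<union> S"] upsetD[OF assms(2) that(2), of "R \<union> S"] by blast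
    then have "medv_le (embed (\<U> \<inter> \<V>)) (avoiding F (R \<union> S))" by (rule embed_le_avoiding[OF subI])
    then show ?thesis by (rule medv_le_trans[OF _ avoiding_Un_le])
  qed
  then have "medv_le (embed (\<U> \<inter> \<V>)) (mass_join (avoiding F R) (embed \<U>))" if "R \<in> \<V>" for R
    using le_join_embed_iff[OF sub(1)] False that le_mass_join_right[OF E] by simp
  then have "medv_le (embed (\<U> \<inter> \<V>)) (mass_join (embed \<U>) (avoiding F R))" if "R \<in> \<V>" for R
    using that le_mass_join_commute by blast
  then show ?thesis
    using le_join_embed_iff[OF sub(2)] False le_mass_join_right[OF E] by simp
qed

lemma meet_embed_le_Un:
  assumes "\<U> \<subseteq> Pow T" "\<V> \<subseteq> Pow T"
  shows "medv_le (mass_meet (embed \<U>) (embed \<V>)) (embed (\<U> \<union> \<V>))"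
proof (cases "\<U> = {} \<or> \<V> = {}")
  case True
  then show ?thesis using mass_meet_lower1 mass_meet_lower2 by force
next
  case False
  have "\<U> \<union> \<V> \<subseteq> Pow T" "\<U> \<union> \<V> \<noteq> {}" using assms False by auto
  moreover have "medv_le (mass_meet (embed \<U>) (embed \<V>)) (avoiding F S)" if "S \<in> \<U> \<union> \<V>" for S
    using that mass_meet_le_left[OF embed_le_avoiding[OF assms(1)]]
      mass_meet_le_right[OF embed_le_avoiding[OF assms(2)]] by blast
  moreover have "medv_le (mass_meet (embed \<U>) (embed \<V>)) E"
    using False by (intro mass_meet_le_left embed_le_E assms(1)) simp
  ultimately show ?thesis using le_embed_iff by simp
qed

text \<open>Suppose some \<open>d\<close> in \<open>D\<close> is computable from \<open>F t\<close>
  with \<open>t\<close> in \<open>R - S\<close>. By the antichain condition \<open>F t\<close> lies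
  in \<open>avoiding F S\<close>, so \<open>F t\<close> and \<open>d\<close> together yield an
  element of \<open>avoiding F R\<close> computable from \<open>F t\<close>, although
  \<open>t\<close> is in \<open>R\<close>.\<close>

lemma avoiding_residual:
  assumes "S \<subseteq> T" "R \<subseteq> T" "medv_le (avoiding F R) (mass_join (avoiding F S) D)"
  shows "medv_le (avoiding F (R - S)) D"
proof (rule medv_le_subset, rule subsetI)
  fix d assume d: "d \<in> D"
  have "\<not> turing_le d (F t)" if t: "t \<in> R - S" for t
  proof
    assume le: "turing_le d (F t)"
    have "\<not> turing_le (F t) (F s)" if "s \<in> S" for s
      using antichain[of t s] assms(1,2) t that by auto
    then have "fun_join (F t) d \<in> mass_join (avoiding F S) D"
      using d by (auto simp: mass_join_def avoiding_def)
    then obtain p g where "g \<in> avoiding F R" "run (fun_join (F t) d) p = Some \<circ> g"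
      using assms(3) unfolding medv_le_iff by blast
    moreover have "turing_le (fun_join (F t) d) (F t)"
      by (rule turing_le_fun_join[OF turing_le_total_rec le]) (rule total_rec_query, rule total_rec_id)
    ultimately have "turing_le g (F t)" "g \<in> avoiding F R"
      using turing_le_trans[of g "fun_join (F t) d" "F t"] by (auto simp: turing_le_def)
    with t show False by (simp add: avoiding_def)
  qed
  then show "d \<in> avoiding F (R - S)" by (simp add: avoiding_def)
qed

text \<open>\<open>E\<close> is an implication with premise \<open>avoiding F T\<close>, which lies
  above \<open>avoiding F S\<close>; a premise used twice counts once.\<close>

lemma E_residual:
  assumes "S \<subseteq> T" "medv_le E (mass_join (avoiding F S) D)"
  shows "medv_le E D"
proof -
  let ?Q = "avoiding F T"
  have "medv_le (avoiding F S) ?Q" using assms(1) by (intro medv_le_subset avoiding_antimono)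
  then have "medv_le (mass_join (avoiding F S) D) (mass_join ?Q D)" by (intro mass_join_mono medv_le_refl)
  with assms(2) have "medv_le E (mass_join ?Q D)" by (rule medv_le_trans)
  then have "medv_le (mass_join ?Q E) (mass_join ?Q D)" by (rule mass_join_least[OF mass_join_upper1])
  with B_le_iff[THEN iffD2, OF medv_le_refl] have "medv_le B (mass_join ?Q D)" by (rule medv_le_trans)
  then show ?thesis by (rule B_le_iff[THEN iffD1])
qed

text \<open>\<open>mass_meet_splits\<close> breaks \<open>D\<close> into a part for the first entry
  and a part for the rest of the list, so the residual of the meet is bounded entry by
  entry.\<close>

lemma meet_list_residual:
  assumes S: "S \<subseteq> T" and "medv_le G E"
  shows "medv_le (meet_list (map (avoiding F) l) E) (mass_join (avoiding F S) D) \<Longrightarrow>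
    (\<forall>R\<in>set l. R \<subseteq> T \<and> medv_le G (avoiding F (R - S))) \<Longrightarrow> medv_le G D"
proof (induction l arbitrary: D)
  case Nil
  then show ?case using E_residual[OF S, of D] medv_le_trans[OF assms(2)] by simp
next
  case (Cons R l)
  have "avoiding F T \<subseteq> avoiding F S" using S by (rule avoiding_antimono)
  \<comment> \<open>The empty problem lies above \<open>B\<close>, but \<open>avoiding F T\<close>
    does not.\<close>
  then have "avoiding F S \<noteq> {}" using not_B_le medv_le_empty[of B] by auto
  then have "\<exists>D0 D1. medv_le (mass_meet D0 D1) D \<and> medv_le (avoiding F R) (mass_join (avoiding F S) D0) \<and>
      medv_le (meet_list (map (avoiding F) l) E) (mass_join (avoiding F S) D1)"
    by (rule mass_meet_splits) (use Cons.prems(1) in \<open>simp_all add: overwrite_avoiding\<close>)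
  then obtain D0 D1 where D: "medv_le (mass_meet D0 D1) D" "medv_le (avoiding F R) (mass_join (avoiding F S) D0)"
    "medv_le (meet_list (map (avoiding F) l) E) (mass_join (avoiding F S) D1)" by blast
  have "medv_le (avoiding F (R - S)) D0" using avoiding_residual[OF S _ D(2)] Cons.prems(2) by simp
  moreover have "medv_le G (avoiding F (R - S))" using Cons.prems(2) by simp
  ultimately have "medv_le G D0" using medv_le_trans by blast
  moreover have "medv_le G D1" using Cons.IH[OF D(3)] Cons.prems(2) by simp
  ultimately show ?case by (rule medv_le_trans[OF mass_meet_greatest D(1)])
qed

text \<open>For each \<open>R\<close> in \<open>\<V>\<close> the residual
  \<open>avoiding F (R - S)\<close> is an entry of the meet on the left, as
  \<open>(R - S) \<union> S = R \<union> S\<close> is in \<open>\<V>\<close>.\<close>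

lemma embed_residual:
  assumes "upset T \<V>" "\<V> \<noteq> {}" "S \<subseteq> T" "medv_le (embed \<V>) (mass_join (avoiding F S) C)"
  shows "medv_le (embed {P\<in>Pow T. P \<union> S \<in> \<V>}) C"
proof -
  let ?\<W> = "{P\<in>Pow T. P \<union> S \<in> \<V>}"
  have sub: "\<V> \<subseteq> Pow T" using assms(1) by (simp add: upset_def)
  obtain l where l: "set l = \<V>" "embed \<V> = meet_list (map (avoiding F) l) E"
    by (rule embed_eq_meet_list[OF sub assms(2)])
  have "T \<in> ?\<W>" using top_in_upset[OF assms(1,2)] assms(3) by (simp add: Un_absorb2)
  then have "medv_le (embed ?\<W>) E" by (intro embed_le_E) auto
  moreover have "medv_le (embed ?\<W>) (avoiding F (R - S))" if "R \<in> \<V>" for R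
  proof (rule embed_le_avoiding)
    have "R \<subseteq> T" using that sub by blast
    moreover from this have "R \<union> S \<in> \<V>" using assms(3) by (intro upsetD[OF assms(1) that]) auto
    ultimately show "R - S \<in> ?\<W>" by auto
  qed auto
  ultimately show ?thesis
    using meet_list_residual[OF assms(3), of "embed ?\<W>" l C] assms(4) l sub by auto
qed

text \<open>Intersecting with \<open>Pow T\<close> covers the empty family, whose intersection alone
  would be \<open>UNIV\<close>.\<close>

lemma embed_INT_le:
  assumes "finite \<S>" "\<forall>S\<in>\<S>. upset T (\<W> S) \<and> medv_le (embed (\<W> S)) C"
  shows "medv_le (embed (Pow T \<inter> (\<Inter>S\<in>\<S>. \<W> S))) C \<and> upset T (Pow T \<inter> (\<Inter>S\<in>\<S>. \<W> S))"
  using assms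
proof induction
  case empty
  then show ?case by (simp add: embed_Pow_le) (simp add: upset_def)
next
  case (insert S \<S>)
  let ?I = "Pow T \<inter> (\<Inter>S\<in>\<S>. \<W> S)"
  have I: "medv_le (embed ?I) C" "upset T ?I" and S: "upset T (\<W> S)" "medv_le (embed (\<W> S)) C"
    using insert by auto
  have eq: "Pow T \<inter> (\<Inter>S\<in>insert S \<S>. \<W> S) = \<W> S \<inter> ?I" by auto
  show ?case unfolding eq
    by (intro conjI medv_le_trans[OF embed_Int_le[OF S(1) I(2)] mass_join_least[OF S(2) I(1)]]
        upset_Int S(1) I(2))
qed

text \<open>\<open>C\<close> ranges over all mass problems, not only over images of
  \<open>embed\<close>; \<open>imp_factor\<close> demands a residual in this full sense.\<close>

lemma embed_imp:
  assumes "upset T \<U>" "upset T \<V>"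
  shows "medv_le (embed \<V>) (mass_join (embed \<U>) C) \<longleftrightarrow> medv_le (embed (upset_imp T \<U> \<V>)) C"
proof
  have sub: "\<U> \<subseteq> Pow T" "\<V> \<subseteq> Pow T" using assms by (auto simp: upset_def)
  assume le: "medv_le (embed \<V>) (mass_join (embed \<U>) C)"
  consider "\<U> = {}" | "\<U> \<noteq> {}" "\<V> = {}" | "\<U> \<noteq> {}" "\<V> \<noteq> {}" by blast
  then show "medv_le (embed (upset_imp T \<U> \<V>)) C"
  proof cases
    case 1
    then have "upset_imp T \<U> \<V> = Pow T" by (auto simp: upset_imp_def)
    then show ?thesis by (simp add: embed_Pow_le)
  next
    case 2
    have T: "T \<in> \<U>" by (rule top_in_upset[OF assms(1) 2(1)])
    have B: "medv_le B (mass_join (embed \<U>) C)" using le 2(2) embed_empty by simp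
    have "medv_le (mass_join (embed \<U>) C) (mass_join (avoiding F T) C)"
      by (intro mass_join_mono embed_le_avoiding sub T medv_le_refl)
    \<comment> \<open>Density of nonempty upsets: \<open>E\<close>, hence \<open>embed \<U>\<close>,
      lies below \<open>C\<close>, so joining \<open>embed \<U>\<close> to \<open>C\<close> adds
      nothing and \<open>B\<close> already lies below \<open>C\<close>.\<close>
    then have "medv_le E C" using B_le_iff[THEN iffD1, OF medv_le_trans[OF B]] by blast
    then have "medv_le (embed \<U>) C" by (rule medv_le_trans[OF embed_le_E[OF sub(1) 2(1)]])
    then have "medv_le B C" by (intro medv_le_trans[OF B] mass_join_least medv_le_refl)
    moreover have "upset_imp T \<U> \<V> = {}" using T 2(2) by (auto simp: upset_imp_def)
    ultimately show ?thesis by (simp add: embed_empty)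
  next
    case 3
    have "medv_le (embed {P\<in>Pow T. P \<union> S \<in> \<V>}) C" if "S \<in> \<U>" for S
    proof (rule embed_residual[OF assms(2) 3(2)])
      show "S \<subseteq> T" using that sub by blast
      have "medv_le (mass_join (embed \<U>) C) (mass_join (avoiding F S) C)"
        by (intro mass_join_mono embed_le_avoiding sub that medv_le_refl)
      with le show "medv_le (embed \<V>) (mass_join (avoiding F S) C)" by (rule medv_le_trans)
    qed
    moreover have "upset T {P\<in>Pow T. P \<union> S \<in> \<V>}" if "S \<in> \<U>" for S
    proof -
      have "P' \<union> S \<in> \<V>" if "P \<union> S \<in> \<V>" "P \<subseteq> P'" "P' \<subseteq> T" for P P'
      proof -
        have "P \<union> S \<subseteq> P' \<union> S" "P' \<union> S \<subseteq> T" using that \<open>S \<in> \<U>\<close> sub by auto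
        then show ?thesis by (rule upsetD[OF assms(2) that(1)])
      qed
      then show ?thesis unfolding upset_def by auto
    qed
    moreover have "finite \<U>" using sub finite_T by (meson finite_Pow_iff finite_subset)
    ultimately show ?thesis unfolding upset_imp_eq[OF assms] by (simp add: embed_INT_le)
  qed
next
  assume "medv_le (embed (upset_imp T \<U> \<V>)) C"
  then have "medv_le (mass_join (embed \<U>) (embed (upset_imp T \<U> \<V>))) (mass_join (embed \<U>) C)"
    by (intro mass_join_mono medv_le_refl)
  moreover have "\<U> \<inter> upset_imp T \<U> \<V> \<subseteq> \<V>" by (auto simp: upset_imp_def)
  then have "medv_le (embed \<V>) (embed (\<U> \<inter> upset_imp T \<U> \<V>))"
    using assms(2) by (intro embed_antimono) (simp_all add: upset_def)
  moreover have "medv_le (embed (\<U> \<inter> upset_imp T \<U> \<V>)) (mass_join (embed \<U>) (embed (upset_imp T \<U> \<V>)))"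
    by (rule embed_Int_le[OF assms(1) upset_upset_imp])
  ultimately show "medv_le (embed \<V>) (mass_join (embed \<U>) C)"
    by (meson medv_le_trans)
qed

text \<open>If a finite meet lies below a single function, so does one of its entries.
  \<open>E\<close> does not, else \<open>B\<close> would be reducible to
  \<open>avoiding F T\<close>; and \<open>avoiding F S\<close> contains no computable function
  unless \<open>S\<close> is empty.\<close>

lemma embed_le_zero:
  assumes "\<V> \<subseteq> Pow T" "medv_le (embed \<V>) {\<lambda>_. 0}"
  shows "{} \<in> \<V>"
proof (cases "\<V> = {}")
  case True
  then show ?thesis using assms B_nonzero by (simp add: embed_empty)
next
  case False
  obtain l where l: "set l = \<V>" "embed \<V> = meet_list (map (avoiding F) l) E"
    by (rule embed_eq_meet_list[OF assms(1) False])
  have "\<not> medv_le E {\<lambda>_. 0}"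
  proof
    assume "medv_le E {\<lambda>_. 0}"
    then have "medv_le B (mass_join (avoiding F T) {\<lambda>_. 0})" using B_le_iff by blast
    moreover have "medv_le {\<lambda>_. 0} (avoiding F T)"
      by (rule medv_leI[of "\<lambda>f x. 0"]) (auto intro: rec_intros)
    then have "medv_le (mass_join (avoiding F T) {\<lambda>_. 0}) (avoiding F T)"
      by (rule mass_join_least[OF medv_le_refl])
    ultimately show False using not_B_le medv_le_trans by blast
  qed
  then obtain S where S: "S \<in> \<V>" "medv_le (avoiding F S) {\<lambda>_. 0}"
    using meet_list_le_singleton[of "map (avoiding F) l" E] assms(2) l by auto
  then obtain g where "g \<in> avoiding F S" "turing_le g (\<lambda>_. 0)" unfolding medv_le_iff turing_le_def by blast
  then have "S = {}" using computable_imp_turing_le unfolding computable_iff avoiding_def by blast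
  with S(1) show ?thesis by simp
qed

end

section \<open>Factors of the Medvedev lattice\<close>

lemma degree_eq_iff: "degree X = degree Y \<longleftrightarrow> medv_le X Y \<and> medv_le Y X"
  using eq_equiv_class_iff[OF equiv_medv_eq, of X Y] by (simp add: degree_def medv_eq_def)

lemma carrier_medvedev: "carrier medvedev = range degree"
  by (auto simp: medvedev_def degree_def quotient_def)

lemma lift2_class:
  assumes "equiv A R" "a \<in> A" "b \<in> A"
    and "\<And>a a' b b'. (a, a') \<in> R \<Longrightarrow> (b, b') \<in> R \<Longrightarrow> (h a b, h a' b') \<in> R"
  shows "lift2 R h (R `` {a}) (R `` {b}) = R `` {h a b}"
  unfolding lift2_def
proof (rule UN_equiv_class2[OF assms(1,1) _ assms(2,3)])
  show "congruent2 R R (\<lambda>a b. R `` {h a b})"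
    using assms(4) equiv_class_eq[OF assms(1)] by (intro congruent2I') blast
qed

lemma join_medvedev: "join medvedev (degree X) (degree Y) = degree (mass_join X Y)"
  unfolding medvedev_def degree_def
  by (simp, rule lift2_class[OF equiv_medv_eq]) (auto simp: medv_eq_def mass_join_mono)

lemma mass_meet_mono: "medv_le X X' \<Longrightarrow> medv_le Y Y' \<Longrightarrow> medv_le (mass_meet X Y) (mass_meet X' Y')"
  by (simp add: le_mass_meet_iff mass_meet_le_left mass_meet_le_right)

lemma meet_medvedev: "meet medvedev (degree X) (degree Y) = degree (mass_meet X Y)"
  unfolding medvedev_def degree_def
  by (simp, rule lift2_class[OF equiv_medv_eq]) (auto simp: medv_eq_def mass_meet_mono)

lemma le_medvedev: "le medvedev (degree X) (degree Y) \<longleftrightarrow> medv_le X Y"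
  by (simp add: le_def meet_medvedev degree_eq_iff le_mass_meet_iff mass_meet_lower1 medv_le_refl)

section \<open>The congruence of the filter above \<open>B\<close>\<close>

definition factor_cong :: "mass \<Rightarrow> (mass set \<times> mass set) set" where
  "factor_cong B = filter_cong medvedev {z \<in> carrier medvedev. le medvedev (degree B) z}"

definition factor_class :: "mass \<Rightarrow> mass \<Rightarrow> mass set set" where
  "factor_class B X = factor_cong B `` {degree X}"

text \<open>The filter has least element \<open>B\<close>, so congruence means equal meets with
  \<open>B\<close>; the two inequalities are what is left after dropping the trivial halves.\<close>

lemma factor_cong_iff:
  "(degree X, degree Y) \<in> factor_cong B \<longleftrightarrow> medv_le (mass_meet X B) Y \<and> medv_le (mass_meet Y B) X"
proof
  assume "(degree X, degree Y) \<in> factor_cong B"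
  then obtain Z where Z: "medv_le B Z" "medv_le (mass_meet X Z) (mass_meet Y Z)" "medv_le (mass_meet Y Z) (mass_meet X Z)"
    by (auto simp: factor_cong_def filter_cong_def carrier_medvedev meet_medvedev le_medvedev degree_eq_iff)
  have "medv_le (mass_meet X B) (mass_meet X Z)" "medv_le (mass_meet Y B) (mass_meet Y Z)"
    by (intro mass_meet_mono medv_le_refl Z(1))+
  with Z(2,3) show "medv_le (mass_meet X B) Y \<and> medv_le (mass_meet Y B) X"
    using medv_le_trans mass_meet_lower1 by meson
next
  assume "medv_le (mass_meet X B) Y \<and> medv_le (mass_meet Y B) X"
  then have "meet medvedev (degree X) (degree B) = meet medvedev (degree Y) (degree B)"
    by (simp add: meet_medvedev degree_eq_iff le_mass_meet_iff mass_meet_lower2)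
  moreover have "le medvedev (degree B) (degree B)" by (simp add: le_medvedev medv_le_refl)
  ultimately show "(degree X, degree Y) \<in> factor_cong B"
    unfolding factor_cong_def filter_cong_def by (auto simp: carrier_medvedev)
qed

lemma factor_cong_elim:
  assumes "(a, b) \<in> factor_cong B"
  obtains X Y where "a = degree X" "b = degree Y" "medv_le (mass_meet X B) Y" "medv_le (mass_meet Y B) X"
proof -
  have "a \<in> range degree" "b \<in> range degree"
    using assms by (auto simp: factor_cong_def filter_cong_def carrier_medvedev)
  with assms that show ?thesis using factor_cong_iff by auto
qed

lemma meet_factor_trans:
  assumes "medv_le (mass_meet X B) Y" "medv_le (mass_meet Y B) Z"
  shows "medv_le (mass_meet X B) Z"
proof -
  have "medv_le (mass_meet X B) (mass_meet Y B)" using assms(1) mass_meet_lower2 by (simp add: le_mass_meet_iff)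
  with assms(2) show ?thesis using medv_le_trans by blast
qed

lemma equiv_factor_cong: "equiv (carrier medvedev) (factor_cong B)"
proof (rule equivI)
  show "factor_cong B \<subseteq> carrier medvedev \<times> carrier medvedev"
    by (auto simp: factor_cong_def filter_cong_def)
  show "refl_on (carrier medvedev) (factor_cong B)"
    by (auto simp: refl_on_def carrier_medvedev factor_cong_iff mass_meet_lower1)
  show "sym (factor_cong B)" by (rule symI, erule factor_cong_elim) (simp add: factor_cong_iff)
  show "trans (factor_cong B)"
  proof (rule transI)
    fix a b c assume ab: "(a, b) \<in> factor_cong B" and bc: "(b, c) \<in> factor_cong B"
    from ab obtain X Y where X: "a = degree X" "b = degree Y" by (rule factor_cong_elim)
    from bc obtain Z where Z: "c = degree Z" by (rule factor_cong_elim)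
    show "(a, c) \<in> factor_cong B" using ab bc unfolding X Z factor_cong_iff using meet_factor_trans by blast
  qed
qed

lemma factor_class_eq_iff:
  "factor_class B X = factor_class B Y \<longleftrightarrow> medv_le (mass_meet X B) Y \<and> medv_le (mass_meet Y B) X"
  unfolding factor_class_def
  using eq_equiv_class_iff[OF equiv_factor_cong, of "degree X" "degree Y" B] by (simp add: carrier_medvedev factor_cong_iff)

lemma carrier_factor: "carrier (factor medvedev (degree B)) = range (factor_class B)"
  by (simp add: factor_def filter_quotient_def Let_def factor_cong_def[symmetric])
    (auto simp: factor_class_def quotient_def carrier_medvedev)

text \<open>One half of distributivity; it makes joins compatible with the congruence.\<close>

lemma mass_meet_join_le: "medv_le (mass_meet (mass_join X Y) B) (mass_join (mass_meet X B) (mass_meet Y B))"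
  unfolding le_mass_join_meet_iff le_mass_join_commute[of _ "mass_meet X B"]
  by (auto intro: mass_meet_lower1 mass_meet_le_right le_mass_join_left le_mass_join_right medv_le_refl
      simp: le_mass_join_commute[of _ Y X])

lemma join_factor: "join (factor medvedev (degree B)) (factor_class B X) (factor_class B Y) = factor_class B (mass_join X Y)"
proof -
  have "lift2 (factor_cong B) (join medvedev) (factor_cong B `` {degree X}) (factor_cong B `` {degree Y})
    = factor_cong B `` {join medvedev (degree X) (degree Y)}"
  proof (rule lift2_class[OF equiv_factor_cong])
    fix a a' b b' assume "(a, a') \<in> factor_cong B" "(b, b') \<in> factor_cong B"
    then show "(join medvedev a b, join medvedev a' b') \<in> factor_cong B"
      by (auto elim!: factor_cong_elim simp: join_medvedev factor_cong_iff
          intro!: medv_le_trans[OF mass_meet_join_le] mass_join_mono)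
  qed (auto simp: carrier_medvedev)
  then show ?thesis
    by (simp add: factor_def filter_quotient_def Let_def factor_cong_def[symmetric] factor_class_def join_medvedev)
qed

lemma meet_factor: "meet (factor medvedev (degree B)) (factor_class B X) (factor_class B Y) = factor_class B (mass_meet X Y)"
proof -
  have "lift2 (factor_cong B) (meet medvedev) (factor_cong B `` {degree X}) (factor_cong B `` {degree Y})
    = factor_cong B `` {meet medvedev (degree X) (degree Y)}"
  proof (rule lift2_class[OF equiv_factor_cong])
    have "medv_le (mass_meet (mass_meet X Y) B) (mass_meet X' Y')"
      if "medv_le (mass_meet X B) X'" "medv_le (mass_meet Y B) Y'" for X Y X' Y'
      by (intro mass_meet_greatest medv_le_trans[OF mass_meet_mono[OF mass_meet_lower1 medv_le_refl] that(1)]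
          medv_le_trans[OF mass_meet_mono[OF mass_meet_lower2 medv_le_refl] that(2)])
    then show "(meet medvedev a b, meet medvedev a' b') \<in> factor_cong B"
      if "(a, a') \<in> factor_cong B" "(b, b') \<in> factor_cong B" for a a' b b'
      using that by (auto elim!: factor_cong_elim simp: meet_medvedev factor_cong_iff)
  qed (auto simp: carrier_medvedev)
  then show ?thesis
    by (simp add: factor_def filter_quotient_def Let_def factor_cong_def[symmetric] factor_class_def meet_medvedev)
qed

lemma least_factor: "least (factor medvedev (degree B)) = factor_class B UNIV"
  by (simp add: factor_def filter_quotient_def Let_def factor_cong_def[symmetric] factor_class_def)
    (simp add: medvedev_def)

text \<open>Both \<open>{}\<close> and \<open>B\<close> lie in the filter, which is collapsed. With
  \<open>B\<close> as representative, \<open>Falsum\<close> corresponds to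
  \<open>embed {}\<close>.\<close>

lemma greatest_factor: "greatest (factor medvedev (degree B)) = factor_class B B"
proof -
  have "greatest (factor medvedev (degree B)) = factor_class B {}"
    by (simp add: factor_def filter_quotient_def Let_def factor_cong_def[symmetric] factor_class_def)
      (simp add: medvedev_def)
  also have "\<dots> = factor_class B B"
    by (simp add: factor_class_eq_iff mass_meet_lower2 medv_le_empty)
  finally show ?thesis .
qed

text \<open>When the left representative lies below \<open>B\<close>, the order of classes is
  reducibility of representatives. Hence a residual \<open>R\<close> below \<open>B\<close>
  satisfies the condition in the \<open>THE\<close>, and antisymmetry gives uniqueness.\<close>

lemma imp_factor:
  assumes "medv_le Y B" "medv_le R B" and R: "\<And>S. medv_le Y (mass_join X S) \<longleftrightarrow> medv_le R S"
  shows "imp (factor medvedev (degree B)) (factor_class B X) (factor_class B Y) = factor_class B R"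
proof -
  let ?L = "factor medvedev (degree B)"
  have le: "meet ?L (factor_class B P) (factor_class B S) = factor_class B P \<longleftrightarrow> medv_le (mass_meet P B) S" for P S
    by (auto simp: meet_factor factor_class_eq_iff le_mass_meet_iff mass_meet_lower1 intro: mass_meet_le_left)
  have below: "medv_le (mass_meet P B) S \<longleftrightarrow> medv_le P S" if "medv_le P B" for P S
    using that mass_meet_le_left medv_le_trans le_mass_meet_iff medv_le_refl by meson
  have "imp ?L (factor_class B X) (factor_class B Y) = (THE r. r \<in> carrier ?L \<and>
    (\<forall>s\<in>carrier ?L. meet ?L (factor_class B Y) (join ?L (factor_class B X) s) = factor_class B Y \<longleftrightarrow> meet ?L r s = r))"
    by (simp add: factor_def filter_quotient_def Let_def)
  also have "\<dots> = factor_class B R"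
  proof (rule the_equality)
    show "factor_class B R \<in> carrier ?L \<and> (\<forall>s\<in>carrier ?L.
      meet ?L (factor_class B Y) (join ?L (factor_class B X) s) = factor_class B Y \<longleftrightarrow> meet ?L (factor_class B R) s = factor_class B R)"
      by (simp add: carrier_factor join_factor le below assms)
  next
    fix r assume r: "r \<in> carrier ?L \<and> (\<forall>s\<in>carrier ?L.
      meet ?L (factor_class B Y) (join ?L (factor_class B X) s) = factor_class B Y \<longleftrightarrow> meet ?L r s = r)"
    then obtain R' where R': "r = factor_class B R'" by (auto simp: carrier_factor)
    have "medv_le R S \<longleftrightarrow> medv_le (mass_meet R' B) S" for S
      using r by (simp add: carrier_factor join_factor le below assms R')
    then show "r = factor_class B R"
      unfolding R' factor_class_eq_iff using medv_le_refl mass_meet_lower1 mass_meet_le_left by blast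
  qed
  finally show ?thesis .
qed

section \<open>The embedding as a homomorphism into the factor\<close>

context antichain_below
begin

lemma val_factor:
  assumes "\<And>i. upset T (V i)"
  shows "val (factor medvedev (degree B)) (\<lambda>i. factor_class B (embed (V i))) A = factor_class B (embed (upset_val T V A))"
proof (induction A)
  case (And A A')
  have "upset T (upset_val T V A)" "upset T (upset_val T V A')" by (intro upset_upset_val assms)+
  then show ?case
    unfolding val.simps And join_factor factor_class_eq_iff upset_val.simps
    by (intro conjI mass_meet_le_left embed_Int_le mass_join_least embed_antimono) (auto simp: upset_def)
next
  case (Or A A')
  have "upset T (upset_val T V A)" "upset T (upset_val T V A')" by (intro upset_upset_val assms)+
  then show ?case
    unfolding val.simps Or meet_factor factor_class_eq_iff upset_val.simps
    by (intro conjI mass_meet_le_left meet_embed_le_Un mass_meet_greatest embed_antimono) (auto simp: upset_def)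
next
  case (Imp A A')
  have up: "upset T (upset_val T V A)" "upset T (upset_val T V A')" by (intro upset_upset_val assms)+
  show ?case
    unfolding val.simps Imp upset_val.simps
  proof (rule imp_factor[OF _ _ embed_imp[OF up]])
    show "medv_le (embed (upset_val T V A')) B" using up(2) by (intro embed_le_B) (simp add: upset_def)
    show "medv_le (embed (upset_imp T (upset_val T V A) (upset_val T V A'))) B"
      by (intro embed_le_B) (auto simp: upset_imp_def)
  qed
qed (simp_all add: greatest_factor embed_empty)

lemma Th_factor_upset_val:
  assumes "A \<in> Th (factor medvedev (degree B))" "\<And>i. upset T (V i)"
  shows "{} \<in> upset_val T V A"
proof -
  have "factor_class B (embed (upset_val T V A)) = factor_class B UNIV"
    using assms(1) unfolding val_factor[OF assms(2), symmetric] Th_def least_factor[symmetric]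
    by (auto simp: carrier_factor)
  then have le: "medv_le (mass_meet (embed (upset_val T V A)) B) UNIV" by (simp add: factor_class_eq_iff)
  have sub: "upset_val T V A \<subseteq> Pow T" using upset_upset_val[OF assms(2)] by (simp add: upset_def)
  have "medv_le (embed (upset_val T V A)) (mass_meet (embed (upset_val T V A)) B)"
    using embed_le_B[OF sub] medv_le_refl by (simp add: le_mass_meet_iff)
  with le have "medv_le (embed (upset_val T V A)) UNIV" using medv_le_trans by blast
  then have "medv_le (embed (upset_val T V A)) {\<lambda>_. 0}" using medv_le_trans medv_le_subset[of _ UNIV] by blast
  with sub show ?thesis by (rule embed_le_zero)
qed

end

lemma ex_antichain_below:
  assumes "medv_less zero_prime B" "finite T"
  shows "\<exists>F E. antichain_below (T :: 'a set) F B E"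
proof -
  have le: "medv_le zero_prime B" and nle: "\<not> medv_le B zero_prime"
    using assms(1) by (auto simp: medv_less_def)
  have "\<exists>f. \<not> computable f \<and> \<not> (\<exists>g\<in>B. run f p = Some \<circ> g)" for p
    using nle unfolding medv_le_iff zero_prime_def by blast
  then obtain f where f: "\<And>p. \<not> computable (f p) \<and> \<not> (\<exists>g\<in>B. run (f p) p = Some \<circ> g)" by metis
  have "countable (range f)" using countable_prog by simp
  then obtain F :: "'a \<Rightarrow> nat \<Rightarrow> nat" where F: "\<forall>s\<in>T. \<not> computable (F s) \<and> (\<forall>g\<in>range f. \<not> turing_le g (F s))"
    "\<forall>s\<in>T. \<forall>t\<in>T. s \<noteq> t \<longrightarrow> \<not> turing_le (F s) (F t)"
    using ex_antichain[OF assms(2), of "range f"] f by blast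
  obtain E where E: "\<forall>C. medv_le B (mass_join (avoiding F T) C) \<longleftrightarrow> medv_le E C"
    using ex_mass_residual by blast
  have "antichain_below T F B E"
  proof
    show "\<not> medv_le B (avoiding F T)"
    proof
      assume "medv_le B (avoiding F T)"
      then obtain p where "\<forall>h\<in>avoiding F T. \<exists>g\<in>B. run h p = Some \<circ> g" unfolding medv_le_iff by blast
      moreover have "f p \<in> avoiding F T" using F(1) by (auto simp: avoiding_def)
      ultimately show False using f by blast
    qed
    show "\<not> medv_le B {\<lambda>_. 0}"
    proof
      assume "medv_le B {\<lambda>_. 0}"
      with le have "medv_le zero_prime {\<lambda>_. 0}" by (rule medv_le_trans)
      then obtain g where "\<not> computable g" "turing_le g (\<lambda>_. 0)"
        unfolding medv_le_iff turing_le_def zero_prime_def by blast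
      then show False by (simp add: computable_iff)
    qed
  qed (use assms(2) F(2) E in auto)
  then show ?thesis by blast
qed

section \<open>Completeness of Jankov's logic\<close>

text \<open>Substitution stays inside \<open>Jan\<close> and is not applied to hypotheses, which
  keeps the deduction theorem \<open>derivable_ImpI\<close> valid.\<close>

inductive_set derivable :: "form set \<Rightarrow> form set" for \<Gamma> :: "form set" where
  Hyp: "A \<in> \<Gamma> \<Longrightarrow> A \<in> derivable \<Gamma>"
| Jan: "A \<in> Jan \<Longrightarrow> A \<in> derivable \<Gamma>"
| MP: "A \<in> derivable \<Gamma> \<Longrightarrow> Imp A B \<in> derivable \<Gamma> \<Longrightarrow> B \<in> derivable \<Gamma>"

lemma derivable_IPC: "A \<in> IPC \<Longrightarrow> A \<in> derivable \<Gamma>"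
  by (intro derivable.Jan Jan.IPC)

lemma derivable_mono: "\<Gamma> \<subseteq> \<Delta> \<Longrightarrow> A \<in> derivable \<Gamma> \<Longrightarrow> A \<in> derivable \<Delta>"
  by (rotate_tac, induction rule: derivable.induct) (auto intro: derivable.intros)

lemma derivable_empty: "A \<in> derivable {} \<Longrightarrow> A \<in> Jan"
  by (induction rule: derivable.induct) (auto intro: Jan.MP)

lemma derivable_ImpI: "A \<in> derivable (insert C \<Gamma>) \<Longrightarrow> Imp C A \<in> derivable \<Gamma>"
proof (induction rule: derivable.induct)
  case (Hyp A)
  have "Imp C C \<in> derivable \<Gamma>"
    by (rule derivable.MP[OF derivable_IPC[OF IPC.K[of C C]]
          derivable.MP[OF derivable_IPC[OF IPC.K[of C "Imp C C"]] derivable_IPC[OF IPC.S]]])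
  with Hyp show ?case using derivable.MP[OF derivable.Hyp derivable_IPC[OF IPC.K]] by blast
next
  case (Jan A)
  then show ?case using derivable.MP[OF derivable.Jan derivable_IPC[OF IPC.K]] by blast
next
  case (MP A B)
  then show ?case using derivable.MP[OF MP.IH(1) derivable.MP[OF MP.IH(2) derivable_IPC[OF IPC.S]]] by blast
qed

section \<open>Prime theories\<close>

definition prime_theory :: "form set \<Rightarrow> bool" where
  "prime_theory \<Gamma> \<longleftrightarrow> derivable \<Gamma> \<subseteq> \<Gamma> \<and> Falsum \<notin> \<Gamma> \<and> (\<forall>A B. Or A B \<in> \<Gamma> \<longrightarrow> A \<in> \<Gamma> \<or> B \<in> \<Gamma>)"

lemma derivable_Union_chain:
  assumes "subset.chain \<A> \<C>" "\<C> \<noteq> {}" "A \<in> derivable (\<Union>\<C>)"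
  shows "\<exists>\<Gamma>\<in>\<C>. A \<in> derivable \<Gamma>"
  using assms(3)
proof (induction rule: derivable.induct)
  case (Hyp A)
  then show ?case by (auto intro: derivable.Hyp)
next
  case (Jan A)
  then show ?case using assms(2) by (auto intro: derivable.Jan)
next
  case (MP A B)
  then obtain \<Gamma> \<Delta> where "\<Gamma> \<in> \<C>" "\<Delta> \<in> \<C>" "A \<in> derivable \<Gamma>" "Imp A B \<in> derivable \<Delta>" by blast
  moreover from this have "\<Gamma> \<subseteq> \<Delta> \<or> \<Delta> \<subseteq> \<Gamma>" using assms(1) by (auto simp: subset_chain_def)
  ultimately show ?case using derivable_mono derivable.MP by metis
qed

text \<open>Zorn's lemma gives a set maximal among those not deriving \<open>A\<close>; if it
  contained a disjunction but neither disjunct, it would derive \<open>A\<close> by cases. The last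
  conclusion records maximality, which \<open>prime_theory_greatest\<close> uses with
  \<open>Falsum\<close> for \<open>A\<close>.\<close>

lemma lindenbaum:
  assumes "A \<notin> derivable \<Gamma>"
  obtains \<Delta> where "\<Gamma> \<subseteq> \<Delta>" "prime_theory \<Delta>" "A \<notin> \<Delta>" "\<forall>C. C \<notin> \<Delta> \<longrightarrow> A \<in> derivable (insert C \<Delta>)"
proof -
  let ?\<A> = "{\<Delta>. \<Gamma> \<subseteq> \<Delta> \<and> A \<notin> derivable \<Delta>}"
  have "\<exists>M\<in>?\<A>. \<forall>X\<in>?\<A>. M \<subseteq> X \<longrightarrow> X = M"
  proof (rule subset_Zorn_nonempty)
    show "?\<A> \<noteq> {}" using assms by blast
    fix \<C> assume \<C>: "\<C> \<noteq> {}" "subset.chain ?\<A> \<C>"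
    then have "\<C> \<subseteq> ?\<A>" by (simp add: subset_chain_def)
    then show "\<Union>\<C> \<in> ?\<A>" using derivable_Union_chain[OF \<C>(2,1)] \<C>(1) by blast
  qed
  then obtain \<Delta> where \<Delta>: "\<Gamma> \<subseteq> \<Delta>" "A \<notin> derivable \<Delta>" and max: "\<And>X. \<Gamma> \<subseteq> X \<Longrightarrow> A \<notin> derivable X \<Longrightarrow> \<Delta> \<subseteq> X \<Longrightarrow> X = \<Delta>"
    by auto
  have ins: "A \<in> derivable (insert C \<Delta>)" if "C \<notin> \<Delta>" for C
    using max[of "insert C \<Delta>"] \<Delta>(1) that by blast
  have imp: "Imp C A \<in> derivable \<Delta>" if "C \<notin> \<Delta>" for C
    using derivable_ImpI[OF ins[OF that]] .
  have closed: "C \<in> \<Delta>" if "C \<in> derivable \<Delta>" for C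
    using derivable.MP[OF that imp] \<Delta>(2) by blast
  have "Falsum \<notin> \<Delta>"
    using derivable.MP[OF derivable.Hyp derivable_IPC[OF IPC.FalsumE]] \<Delta>(2) by blast
  moreover have "C \<in> \<Delta> \<or> D \<in> \<Delta>" if "Or C D \<in> \<Delta>" for C D
  proof (rule ccontr)
    assume "\<not> (C \<in> \<Delta> \<or> D \<in> \<Delta>)"
    then have "Imp C A \<in> derivable \<Delta>" "Imp D A \<in> derivable \<Delta>" using imp by auto
    then have "Imp (Or C D) A \<in> derivable \<Delta>"
      using derivable.MP[OF _ derivable.MP[OF _ derivable_IPC[OF IPC.OrE]]] by blast
    then show False using derivable.MP[OF derivable.Hyp[OF that]] \<Delta>(2) by blast
  qed
  ultimately have "prime_theory \<Delta>" using closed unfolding prime_theory_def by blast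
  moreover have "A \<notin> \<Delta>" using \<Delta>(2) derivable.Hyp by blast
  ultimately show thesis using that \<Delta>(1) ins by blast
qed

context
  fixes \<Gamma> :: "form set"
  assumes prime: "prime_theory \<Gamma>"
begin

lemma prime_theory_derivable: "A \<in> derivable \<Gamma> \<Longrightarrow> A \<in> \<Gamma>"
  using prime by (auto simp: prime_theory_def)

lemma prime_theory_MP: "Imp A B \<in> \<Gamma> \<Longrightarrow> A \<in> \<Gamma> \<Longrightarrow> B \<in> \<Gamma>"
  by (rule prime_theory_derivable, rule derivable.MP[of A]) (auto intro: derivable.Hyp)

lemma prime_theory_IPC: "A \<in> IPC \<Longrightarrow> A \<in> \<Gamma>"
  by (rule prime_theory_derivable, rule derivable_IPC)

lemma prime_theory_And: "And A B \<in> \<Gamma> \<longleftrightarrow> A \<in> \<Gamma> \<and> B \<in> \<Gamma>"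
  using prime_theory_MP prime_theory_IPC[OF IPC.AndE1] prime_theory_IPC[OF IPC.AndE2] prime_theory_IPC[OF IPC.AndI]
  by blast

lemma prime_theory_Or: "Or A B \<in> \<Gamma> \<longleftrightarrow> A \<in> \<Gamma> \<or> B \<in> \<Gamma>"
  using prime prime_theory_MP prime_theory_IPC[OF IPC.OrI1] prime_theory_IPC[OF IPC.OrI2]
  unfolding prime_theory_def by blast

lemma prime_theory_Imp:
  assumes "Imp A B \<notin> \<Gamma>"
  obtains \<Delta> where "\<Gamma> \<subseteq> \<Delta>" "prime_theory \<Delta>" "A \<in> \<Delta>" "B \<notin> \<Delta>"
proof -
  have "B \<notin> derivable (insert A \<Gamma>)" using derivable_ImpI prime_theory_derivable assms by blast
  then show thesis by (rule lindenbaum) (use that in auto)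
qed

lemma prime_theory_wlem: "Neg A \<in> \<Gamma> \<or> Neg (Neg A) \<in> \<Gamma>"
proof -
  have "Or (Neg A) (Neg (Neg A)) \<in> Jan" using Jan.Subst[OF Jan.WLEM, of "\<lambda>_. A"] by simp
  then have "Or (Neg A) (Neg (Neg A)) \<in> \<Gamma>" by (rule prime_theory_derivable[OF derivable.Jan])
  then show ?thesis unfolding prime_theory_Or .
qed

text \<open>Weak excluded middle gives the frame a greatest point. A maximal consistent
  \<open>\<Delta>\<close> contains \<open>Neg A\<close> for each \<open>A\<close> that it lacks. If
  such an \<open>A\<close> belongs to a prime theory above \<open>\<Gamma>\<close>, then
  \<open>Neg A\<close> is not in \<open>\<Gamma>\<close>, so \<open>Neg (Neg A)\<close> is, and
  \<open>\<Delta>\<close> would be inconsistent.\<close>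

lemma prime_theory_greatest:
  obtains \<Delta> where "prime_theory \<Delta>" "\<Gamma> \<subseteq> \<Delta>" "\<forall>\<Sigma>. prime_theory \<Sigma> \<longrightarrow> \<Gamma> \<subseteq> \<Sigma> \<longrightarrow> \<Sigma> \<subseteq> \<Delta>"
proof -
  have "Falsum \<notin> derivable \<Gamma>" using prime by (auto simp: prime_theory_def)
  then obtain \<Delta> where \<Delta>: "\<Gamma> \<subseteq> \<Delta>" "prime_theory \<Delta>" "Falsum \<notin> \<Delta>"
      "\<forall>C. C \<notin> \<Delta> \<longrightarrow> Falsum \<in> derivable (insert C \<Delta>)"
    by (rule lindenbaum)
  have "\<forall>\<Sigma>. prime_theory \<Sigma> \<longrightarrow> \<Gamma> \<subseteq> \<Sigma> \<longrightarrow> \<Sigma> \<subseteq> \<Delta>"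
  proof (intro allI impI subsetI)
    fix \<Sigma> A assume \<Sigma>: "prime_theory \<Sigma>" "\<Gamma> \<subseteq> \<Sigma>" and A: "A \<in> \<Sigma>"
    show "A \<in> \<Delta>"
    proof (rule ccontr)
      assume "A \<notin> \<Delta>"
      have clash: False if "prime_theory \<Theta>" "C \<in> \<Theta>" "Neg C \<in> \<Theta>" for \<Theta> C
      proof -
        have "Falsum \<in> derivable \<Theta>" by (rule derivable.MP[OF that(2,3)[THEN derivable.Hyp]])
        with that(1) show False by (auto simp: prime_theory_def)
      qed
      have "Neg A \<in> derivable \<Delta>" using \<Delta>(4) \<open>A \<notin> \<Delta>\<close> by (simp add: derivable_ImpI)
      then have "Neg A \<in> \<Delta>" using \<Delta>(2) by (auto simp: prime_theory_def)
      moreover have "Neg A \<notin> \<Gamma>" using clash[OF \<Sigma>(1) A] \<Sigma>(2) by auto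
      then have "Neg (Neg A) \<in> \<Delta>" using prime_theory_wlem[of A] \<Delta>(1) by auto
      ultimately show False by (rule clash[OF \<Delta>(2)])
    qed
  qed
  with \<Delta>(2,1) show thesis by (rule that)
qed

end

section \<open>Finite frames\<close>

primrec subforms :: "form \<Rightarrow> form set" where
  "subforms (Var i) = {Var i}"
| "subforms Falsum = {Falsum}"
| "subforms (And A B) = insert (And A B) (subforms A \<union> subforms B)"
| "subforms (Or A B) = insert (Or A B) (subforms A \<union> subforms B)"
| "subforms (Imp A B) = insert (Imp A B) (subforms A \<union> subforms B)"

lemma subforms_refl: "A \<in> subforms A"
  by (cases A) auto

lemma finite_subforms: "finite (subforms A)"
  by (induction A) auto

text \<open>
  In a finite poset \<open>W\<close> with least element \<open>r\<close> and greatest element \<open>m\<close>, send a nonempty chain to its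
  maximum, the empty set to \<open>r\<close> and every other subset to \<open>m\<close>. This is a p-morphism from
  \<open>(Pow W, \<subseteq>)\<close> onto \<open>W\<close>, so Jankov's logic is complete for the frames \<open>Pow W\<close>.
\<close>

definition chain_max :: "'a set set \<Rightarrow> 'a set \<Rightarrow> 'a set \<Rightarrow> 'a set set \<Rightarrow> 'a set" where
  "chain_max W r m S = (if S = {} then r else if subset.chain W S then \<Union>S else m)"

context
  fixes W :: "'a set set" and r m :: "'a set"
  assumes finite_W: "finite W" and r: "r \<in> W" "\<forall>w\<in>W. r \<subseteq> w"
    and m: "m \<in> W" "\<forall>w\<in>W. w \<subseteq> m"
begin

lemma chain_max_in:
  assumes "S \<subseteq> W"
  shows "chain_max W r m S \<in> W"
proof -
  have "\<Union>S \<in> S" if "S \<noteq> {}" "subset.chain W S"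
    using that finite_subset[OF assms finite_W] by (intro Union_in_chain)
  then show ?thesis using assms r(1) m(1) by (auto simp: chain_max_def)
qed

lemma chain_max_mono:
  assumes "S \<subseteq> R" "R \<subseteq> W"
  shows "chain_max W r m S \<subseteq> chain_max W r m R"
proof -
  have S: "chain_max W r m S \<in> W" and R: "chain_max W r m R \<in> W"
    using assms by (auto intro: chain_max_in)
  consider "S = {}" | "\<not> subset.chain W R" "R \<noteq> {}" | "S \<noteq> {}" "R \<noteq> {}" "subset.chain W R"
    using assms(1) by blast
  then show ?thesis
  proof cases
    case 1
    then show ?thesis using r(2) R by (simp add: chain_max_def)
  next
    case 2
    then show ?thesis using m(2) S by (simp add: chain_max_def)
  next
    case 3
    then have "subset.chain W S" using assms(1) unfolding subset_chain_def by blast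
    with 3 show ?thesis using assms(1) by (auto simp: chain_max_def)
  qed
qed

text \<open>The back condition of the p-morphism. If \<open>S\<close> is empty or a chain, adding
  \<open>w\<close> on top gives a chain with maximum \<open>w\<close>; otherwise the value is
  already \<open>m\<close>, and \<open>w = m\<close>.\<close>

lemma chain_max_lift:
  assumes "S \<subseteq> W" "w \<in> W" "chain_max W r m S \<subseteq> w"
  obtains R where "S \<subseteq> R" "R \<subseteq> W" "chain_max W r m R = w"
proof (cases "S = {} \<or> subset.chain W S")
  case True
  have S: "x \<subseteq> w" if "x \<in> S" for x
    using True assms(3) that by (auto simp: chain_max_def split: if_splits)
  have "subset.chain W (insert w S)"
    using True S assms(2) unfolding subset_chain_def by auto
  moreover have "\<Union>(insert w S) = w" using S by auto
  ultimately have "chain_max W r m (insert w S) = w" by (simp add: chain_max_def)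
  then show thesis using assms(1,2) by (intro that[of "insert w S"]) auto
next
  case False
  then have "chain_max W r m S = m" by (simp add: chain_max_def)
  with assms m(2) show thesis by (intro that[of S]) auto
qed

end

text \<open>Filtration: the points are the traces, on the subformulas of \<open>A\<close>, of the
  prime theories above one that omits \<open>A\<close>. There are finitely many, with a least and a
  greatest. The valuation pulled back along the p-morphism refutes \<open>A\<close> at
  \<open>{}\<close>, which goes to the least trace.\<close>

lemma Jan_complete_Pow:
  assumes "A \<notin> Jan"
  obtains T :: "form set set" and V where "finite T" "\<forall>i. upset T (V i)" "{} \<notin> upset_val T V A"
proof -
  have "A \<notin> derivable {}" using assms derivable_empty by blast
  then obtain \<Gamma>0 where "{} \<subseteq> \<Gamma>0" and \<Gamma>0: "prime_theory \<Gamma>0" "A \<notin> \<Gamma>0"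
      and "\<forall>C. C \<notin> \<Gamma>0 \<longrightarrow> A \<in> derivable (insert C \<Gamma>0)"
    by (rule lindenbaum)
  obtain M where M: "prime_theory M" "\<Gamma>0 \<subseteq> M" "\<forall>\<Gamma>. prime_theory \<Gamma> \<longrightarrow> \<Gamma>0 \<subseteq> \<Gamma> \<longrightarrow> \<Gamma> \<subseteq> M"
    by (rule prime_theory_greatest[OF \<Gamma>0(1)])
  define \<Sigma> where "\<Sigma> = subforms A"
  define W where "W = {\<Gamma> \<inter> \<Sigma> | \<Gamma>. prime_theory \<Gamma> \<and> \<Gamma>0 \<subseteq> \<Gamma>}"
  have "W \<subseteq> Pow \<Sigma>" by (auto simp: W_def)
  then have fin: "finite W" using finite_subforms[of A] by (auto simp: \<Sigma>_def intro: finite_subset)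
  let ?r = "\<Gamma>0 \<inter> \<Sigma>" and ?m = "M \<inter> \<Sigma>"
  have frame: "finite W" "?r \<in> W" "\<forall>w\<in>W. ?r \<subseteq> w" "?m \<in> W" "\<forall>w\<in>W. w \<subseteq> ?m"
    using fin \<Gamma>0(1) M by (auto simp: W_def)
  define st where "st = chain_max W ?r ?m"
  note st_in = chain_max_in[OF frame, folded st_def] and st_mono = chain_max_mono[OF frame, folded st_def]
    and st_lift = chain_max_lift[OF frame, folded st_def]
  have st_prime: "\<exists>\<Gamma>. st S = \<Gamma> \<inter> \<Sigma> \<and> prime_theory \<Gamma> \<and> \<Gamma>0 \<subseteq> \<Gamma>" if "S \<subseteq> W" for S
    using st_in[OF that] by (auto simp: W_def)
  define V where "V i = {S\<in>Pow W. Var i \<in> st S}" for i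
  have up: "\<forall>i. upset W (V i)"
  proof
    fix i
    have "R \<in> V i" if "S \<in> V i" "S \<subseteq> R" "R \<subseteq> W" for S R
      using st_mono[OF that(2,3)] that(1,3) by (auto simp: V_def)
    then show "upset W (V i)" unfolding upset_def by (auto simp: V_def)
  qed
  have truth: "upset_val W V C = {S\<in>Pow W. C \<in> st S}" if "subforms C \<subseteq> \<Sigma>" for C
    using that
  proof (induction C)
    case (Var i)
    then show ?case by (simp add: V_def)
  next
    case Falsum
    have "Falsum \<notin> st S" if "S \<subseteq> W" for S
      using st_prime[OF that] by (auto simp: prime_theory_def)
    then show ?case by auto
  next
    case (And C D)
    have sub: "And C D \<in> \<Sigma>" "C \<in> \<Sigma>" "D \<in> \<Sigma>" using And.prems subforms_refl by auto
    have "And C D \<in> st S \<longleftrightarrow> C \<in> st S \<and> D \<in> st S" if S: "S \<subseteq> W" for S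
    proof -
      obtain \<Gamma> where "st S = \<Gamma> \<inter> \<Sigma>" "prime_theory \<Gamma>" using st_prime[OF S] by blast
      then show ?thesis using sub prime_theory_And by auto
    qed
    with And show ?case by auto
  next
    case (Or C D)
    have sub: "Or C D \<in> \<Sigma>" "C \<in> \<Sigma>" "D \<in> \<Sigma>" using Or.prems subforms_refl by auto
    have "Or C D \<in> st S \<longleftrightarrow> C \<in> st S \<or> D \<in> st S" if S: "S \<subseteq> W" for S
    proof -
      obtain \<Gamma> where "st S = \<Gamma> \<inter> \<Sigma>" "prime_theory \<Gamma>" using st_prime[OF S] by blast
      then show ?thesis using sub prime_theory_Or by auto
    qed
    with Or show ?case by auto
  next
    case (Imp C D)
    have sub: "Imp C D \<in> \<Sigma>" "C \<in> \<Sigma>" "D \<in> \<Sigma>" using Imp.prems subforms_refl by auto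
    have "Imp C D \<in> st S \<longleftrightarrow> (\<forall>R. S \<subseteq> R \<longrightarrow> R \<subseteq> W \<longrightarrow> C \<in> st R \<longrightarrow> D \<in> st R)" if S: "S \<subseteq> W" for S
    proof
      assume "Imp C D \<in> st S"
      show "\<forall>R. S \<subseteq> R \<longrightarrow> R \<subseteq> W \<longrightarrow> C \<in> st R \<longrightarrow> D \<in> st R"
      proof (intro allI impI)
        fix R assume R: "S \<subseteq> R" "R \<subseteq> W" "C \<in> st R"
        obtain \<Gamma> where "st R = \<Gamma> \<inter> \<Sigma>" "prime_theory \<Gamma>" using st_prime[OF R(2)] by blast
        moreover have "Imp C D \<in> st R" using st_mono[OF R(1,2)] \<open>Imp C D \<in> st S\<close> by blast
        ultimately show "D \<in> st R" using R(3) sub prime_theory_MP by auto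
      qed
    next
      assume R: "\<forall>R. S \<subseteq> R \<longrightarrow> R \<subseteq> W \<longrightarrow> C \<in> st R \<longrightarrow> D \<in> st R"
      show "Imp C D \<in> st S"
      proof (rule ccontr)
        assume "Imp C D \<notin> st S"
        obtain \<Gamma> where \<Gamma>: "st S = \<Gamma> \<inter> \<Sigma>" "prime_theory \<Gamma>" "\<Gamma>0 \<subseteq> \<Gamma>" using st_prime[OF S] by blast
        with \<open>Imp C D \<notin> st S\<close> sub have "Imp C D \<notin> \<Gamma>" by blast
        then obtain \<Delta> where \<Delta>: "\<Gamma> \<subseteq> \<Delta>" "prime_theory \<Delta>" "C \<in> \<Delta>" "D \<notin> \<Delta>"
          by (rule prime_theory_Imp[OF \<Gamma>(2)])
        \<comment> \<open>The trace of the theory that refutes the implication is a point above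
          \<open>st S\<close>; the back condition realizes it at a set above
          \<open>S\<close>.\<close>
        then have "\<Delta> \<inter> \<Sigma> \<in> W" "st S \<subseteq> \<Delta> \<inter> \<Sigma>" using \<Gamma> unfolding W_def by blast+
        then obtain Q where "S \<subseteq> Q" "Q \<subseteq> W" "st Q = \<Delta> \<inter> \<Sigma>" by (rule st_lift[OF S])
        with R \<Delta>(3,4) sub show False by blast
      qed
    qed
    moreover have "upset_val W V C = {S\<in>Pow W. C \<in> st S}" "upset_val W V D = {S\<in>Pow W. D \<in> st S}"
      using Imp by auto
    ultimately show ?case by (auto simp: upset_imp_def)
  qed
  have "st {} = ?r" by (simp add: st_def chain_max_def)
  then have "{} \<notin> upset_val W V A" using truth[of A] \<Gamma>0(2) by (simp add: \<Sigma>_def)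
  with fin up show thesis by (rule that)
qed

theorem corollary5p3:
  fixes B :: mass
  assumes "medv_less zero_prime B"
  shows "Th (factor medvedev (degree B)) \<subseteq> Jan"
proof
  fix A assume A: "A \<in> Th (factor medvedev (degree B))"
  show "A \<in> Jan"
  proof (rule ccontr)
    assume "A \<notin> Jan"
    then obtain T :: "form set set" and V where T: "finite T" "\<forall>i. upset T (V i)" "{} \<notin> upset_val T V A"
      by (rule Jan_complete_Pow) blast
    obtain F E where "antichain_below T F B E" using ex_antichain_below[OF assms T(1)] by blast
    from antichain_below.Th_factor_upset_val[OF this A, of V] T(2,3) show False by blast
  qed
qed

end
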